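(* Let $G$ be a finite group and let $X$ be a $G$-space. (1) For $n\geq 0$, there is a disjoint union decomposition $$C_n(X)^G\cong\coprod_{|S|=n}C^G_S(X),$$ where the disjoint union runs over isomorphism classes of finite $G$-sets $S$ with cardinality $n$. (2) Let $S$ be the finite $G$-set $$S=\bigsqcup_{(H)}k_{(H)}[G/H],$$ where $k_{(H)}\geq 0$ for each conjugacy class of subgroups $(H)$. Then $$C^G_S(X)\cong\prod_{(H)}C_{k_{(H)}}\big(X_{(H)}/G\big).$$
   Context: For a space $Y$, $C_n(Y)=\{(y_1,\dots,y_n)\in Y^n: y_i\neq y_j\text{ for all }i\ne j\}/\Sigma_n$ is the space of unordered configurations of $n$ points in $Y$, where $\Sigma_n$ permutes the points; if $Y$ is a $G$-space, then $C_n(Y)$ is a $G$-space with $G$ acting diagonally, and $C_n(Y)^G$ is its space of $G$-fixed points. For a finite $G$-set $S$, the space of unordered $S$-configurations in $X$ is $C_S^G(X)=\operatorname{Emb}^G(S,X)/\operatorname{Aut}(S)$, where $\operatorname{Emb}^G(S,X)$ is the space of $G$-equivariant embeddings $S\to X$ and $\operatorname{Aut}(S)$ is the group of $G$-set automorphisms of $S$, acting by precomposition. $k[G/H]$ denotes the disjoint union of $k$ copies of the orbit $G/H$. For $H\le G$, $(H)$ denotes the conjugacy class of $H$, and $X_{(H)}=\{x\in X: (G_x)=(H)\}$ is the subspace of points whose stabilizer $G_x$ is conjugate to $H$, with its restricted $G$-action.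
   Formalization: X is assumed Hausdorff: for general G-spaces the claim fails, e.g. the line with two origins p, q with Z/2 fixing p, q and x ↦ -x elsewhere, where C_2(X)^G is connected but the coproduct is a point plus an open half-line. *)

theory Defs
  imports
    "HOL-Algebra.Group_Action"
    "HOL-Algebra.Left_Coset"
    "HOL-Combinatorics.Permutations"
    "HOL-Analysis.Function_Topology"
    "HOL-Analysis.Sum_Topology"
    "HOL-Analysis.T1_Spaces"
begin

section \<open>Quotient spaces\<close>

text \<open>Points of a quotient are equivalence classes; \<open>q\<close> sends a point to its class.\<close>

definition quotient_topology :: "'a topology \<Rightarrow> ('a \<Rightarrow> 'b) \<Rightarrow> 'b topology" where
  "quotient_topology X q =
     topology (\<lambda>U. U \<subseteq> q ` topspace X \<and> openin X {x \<in> topspace X. q x \<in> U})"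

lemma openin_quotient_topology:
  "openin (quotient_topology X q) U \<longleftrightarrow>
     U \<subseteq> q ` topspace X \<and> openin X {x \<in> topspace X. q x \<in> U}"
proof -
  have "{x \<in> topspace X. q x \<in> S \<inter> T}
      = {x \<in> topspace X. q x \<in> S} \<inter> {x \<in> topspace X. q x \<in> T}" for S T
    by auto
  moreover have "{x \<in> topspace X. q x \<in> \<Union>K} = (\<Union>S\<in>K. {x \<in> topspace X. q x \<in> S})" for K
    by auto
  ultimately have "istopology (\<lambda>U. U \<subseteq> q ` topspace X \<and> openin X {x \<in> topspace X. q x \<in> U})"
    unfolding istopology_def by (auto intro!: openin_Int openin_Union simp del: Union_iff)
  then show ?thesis
    unfolding quotient_topology_def by (simp add: topology_inverse')
qed

lemma topspace_quotient_topology [simp]: "topspace (quotient_topology X q) = q ` topspace X"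
proof
  show "topspace (quotient_topology X q) \<subseteq> q ` topspace X"
    by (auto simp: topspace_def openin_quotient_topology)
  have "{x \<in> topspace X. q x \<in> q ` topspace X} = topspace X" by auto
  then have "openin (quotient_topology X q) (q ` topspace X)"
    by (simp add: openin_quotient_topology)
  then show "q ` topspace X \<subseteq> topspace (quotient_topology X q)"
    by (rule openin_subset)
qed

lemma quotient_map_quotient_topology: "quotient_map X (quotient_topology X q) q"
  by (auto simp: quotient_map_def openin_quotient_topology)


section \<open>G-spaces\<close>

text \<open>Groups are discrete here, so continuity of the action is continuity of each translation.
  Hausdorffness is not part of \<open>G_space\<close> but is assumed of spaces where needed: on the line with
  two origins \<open>p\<close>, \<open>q\<close>, let the group of order 2 fix \<open>p\<close>, \<open>q\<close> and act by \<open>x \<mapsto> -x\<close> elsewhere; then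
  \<open>{-x, x}\<close> tends to \<open>{p, q}\<close> as \<open>x\<close> tends to 0, so fixed configurations of different orbit types
  are not separated.\<close>

definition G_space :: "('g, 'm) monoid_scheme \<Rightarrow> 'x topology \<Rightarrow> ('g \<Rightarrow> 'x \<Rightarrow> 'x) \<Rightarrow> bool" where
  "G_space G X \<phi> \<longleftrightarrow>
     group_action G (topspace X) \<phi> \<and> (\<forall>g \<in> carrier G. continuous_map X X (\<phi> g))"

definition orbit_space :: "('g, 'm) monoid_scheme \<Rightarrow> ('g \<Rightarrow> 'x \<Rightarrow> 'x) \<Rightarrow> 'x topology \<Rightarrow> 'x set topology"
  where "orbit_space G \<phi> X = quotient_topology X (orbit G \<phi>)"

definition conj_act :: "('g, 'm) monoid_scheme \<Rightarrow> 'g \<Rightarrow> 'g set \<Rightarrow> 'g set" where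
  "conj_act G = (\<lambda>g. \<lambda>H \<in> {H. subgroup H G}. g <#\<^bsub>G\<^esub> H #>\<^bsub>G\<^esub> (inv\<^bsub>G\<^esub> g))"

definition conj_class :: "('g, 'm) monoid_scheme \<Rightarrow> 'g set \<Rightarrow> 'g set set" where
  "conj_class G H = orbit G (conj_act G) H"

definition conj_classes :: "('g, 'm) monoid_scheme \<Rightarrow> 'g set set set" where
  "conj_classes G = orbits G {H. subgroup H G} (conj_act G)"

text \<open>The subspace \<open>X\<^bsub>(H)\<^esub>\<close>, where \<open>c\<close> is the conjugacy class \<open>(H)\<close>.\<close>

definition stratum ::
  "('g, 'm) monoid_scheme \<Rightarrow> ('g \<Rightarrow> 'x \<Rightarrow> 'x) \<Rightarrow> 'x topology \<Rightarrow> 'g set set \<Rightarrow> 'x topology" where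
  "stratum G \<phi> X c = subtopology X {x \<in> topspace X. conj_class G (stabilizer G \<phi> x) = c}"


section \<open>Unordered configurations\<close>

definition ordered_conf :: "'y topology \<Rightarrow> nat \<Rightarrow> (nat \<Rightarrow> 'y) topology" where
  "ordered_conf Y n = subtopology (product_topology (\<lambda>_. Y) {..<n}) {y. inj_on y {..<n}}"

definition conf :: "'y topology \<Rightarrow> nat \<Rightarrow> (nat \<Rightarrow> 'y) set topology" where
  "conf Y n = quotient_topology (ordered_conf Y n) (\<lambda>y. {y \<circ> \<sigma> | \<sigma>. \<sigma> permutes {..<n}})"

definition conf_act :: "('g \<Rightarrow> 'y \<Rightarrow> 'y) \<Rightarrow> nat \<Rightarrow> 'g \<Rightarrow> (nat \<Rightarrow> 'y) set \<Rightarrow> (nat \<Rightarrow> 'y) set" where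
  "conf_act \<phi> n g c = (\<lambda>y. \<lambda>i \<in> {..<n}. \<phi> g (y i)) ` c"

definition conf_fixed ::
  "('g, 'm) monoid_scheme \<Rightarrow> ('g \<Rightarrow> 'y \<Rightarrow> 'y) \<Rightarrow> 'y topology \<Rightarrow> nat \<Rightarrow> (nat \<Rightarrow> 'y) set topology" where
  "conf_fixed G \<phi> Y n = subtopology (conf Y n) {c. \<forall>g \<in> carrier G. conf_act \<phi> n g c = c}"


section \<open>Finite G-sets and S-configurations\<close>

type_synonym ('g, 's) gset = "'s set \<times> ('g \<Rightarrow> 's \<Rightarrow> 's)"

definition equivariant ::
  "('g, 'm) monoid_scheme \<Rightarrow> 's set \<Rightarrow> ('g \<Rightarrow> 's \<Rightarrow> 's) \<Rightarrow> ('g \<Rightarrow> 't \<Rightarrow> 't) \<Rightarrow> ('s \<Rightarrow> 't) \<Rightarrow> bool" where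
  "equivariant G A \<alpha> \<beta> f \<longleftrightarrow> (\<forall>g \<in> carrier G. \<forall>s \<in> A. f (\<alpha> g s) = \<beta> g (f s))"

definition gset_iso :: "('g, 'm) monoid_scheme \<Rightarrow> ('g, 's) gset \<Rightarrow> ('g, 't) gset \<Rightarrow> bool" where
  "gset_iso G S T \<longleftrightarrow>
     (\<exists>f. bij_betw f (fst S) (fst T) \<and> equivariant G (fst S) (snd S) (snd T) f)"

definition gset_aut :: "('g, 'm) monoid_scheme \<Rightarrow> ('g, 's) gset \<Rightarrow> ('s \<Rightarrow> 's) set" where
  "gset_aut G S = {f \<in> Bij (fst S). equivariant G (fst S) (snd S) (snd S) f}"

definition finite_gsets :: "('g, 'm) monoid_scheme \<Rightarrow> nat \<Rightarrow> ('g, 's) gset set" where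
  "finite_gsets G n = {(A, \<alpha>). group_action G A \<alpha> \<and> finite A \<and> card A = n}"

text \<open>
  The G-sets with underlying set a finite set of natural numbers represent all isomorphism
  classes of finite G-sets (lemma \<open>gset_iso_nat\<close> below), so restricting to them loses nothing.
\<close>

definition gset_iso_classes :: "('g, 'm) monoid_scheme \<Rightarrow> nat \<Rightarrow> ('g, nat) gset set set" where
  "gset_iso_classes G n =
     finite_gsets G n // {(S, T). S \<in> finite_gsets G n \<and> T \<in> finite_gsets G n \<and> gset_iso G S T}"

text \<open>
  The finite set \<open>S\<close> is discrete, so the mapping space topology is that of the power \<open>X\<^sup>S\<close>.
\<close>

definition gemb ::
  "('g, 'm) monoid_scheme \<Rightarrow> ('g, 's) gset \<Rightarrow> 'x topology \<Rightarrow> ('g \<Rightarrow> 'x \<Rightarrow> 'x) \<Rightarrow> ('s \<Rightarrow> 'x) topology" where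
  "gemb G S X \<phi> = subtopology (product_topology (\<lambda>_. X) (fst S))
     {f. embedding_map (discrete_topology (fst S)) X f \<and> equivariant G (fst S) (snd S) \<phi> f}"

definition gconf ::
  "('g, 'm) monoid_scheme \<Rightarrow> ('g, 's) gset \<Rightarrow> 'x topology \<Rightarrow> ('g \<Rightarrow> 'x \<Rightarrow> 'x) \<Rightarrow> ('s \<Rightarrow> 'x) set topology" where
  "gconf G S X \<phi> =
     quotient_topology (gemb G S X \<phi>) (\<lambda>f. {compose (fst S) f a | a. a \<in> gset_aut G S})"

text \<open>
  The G-set \<open>\<Squnion>\<^bsub>(H)\<^esub> k\<^bsub>(H)\<^esub>[G/H]\<close>: \<open>R c\<close> is the chosen subgroup \<open>H\<close> in the conjugacy class \<open>c\<close>, and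
  \<open>(c, i, C)\<close> is the coset \<open>C\<close> in the \<open>i\<close>-th copy of \<open>G / R c\<close>.
\<close>

definition orbit_sum ::
  "('g, 'm) monoid_scheme \<Rightarrow> ('g set set \<Rightarrow> 'g set) \<Rightarrow> ('g set set \<Rightarrow> nat)
     \<Rightarrow> ('g, 'g set set \<times> nat \<times> 'g set) gset" where
  "orbit_sum G R k =
     (let A = {(c, i, C). c \<in> conj_classes G \<and> i < k c \<and> C \<in> lcosets\<^bsub>G\<^esub> (R c)}
      in (A, \<lambda>g. \<lambda>(c, i, C) \<in> A. (c, i, g <#\<^bsub>G\<^esub> C)))"

lemma group_action_iff:
  "group_action G A \<alpha> \<longleftrightarrow> group G \<and> (\<forall>g \<in> carrier G. \<alpha> g \<in> Bij A) \<and>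
     (\<forall>g \<in> carrier G. \<forall>h \<in> carrier G. \<alpha> (g \<otimes>\<^bsub>G\<^esub> h) = compose A (\<alpha> g) (\<alpha> h))"
proof -
  have "\<alpha> \<in> hom G (BijGroup A) \<longleftrightarrow> (\<forall>g \<in> carrier G. \<alpha> g \<in> Bij A) \<and>
     (\<forall>g \<in> carrier G. \<forall>h \<in> carrier G. \<alpha> (g \<otimes>\<^bsub>G\<^esub> h) = compose A (\<alpha> g) (\<alpha> h))"
    by (auto simp: hom_def BijGroup_def Pi_iff)
  then show ?thesis
    by (simp add: group_action_def group_hom_def group_hom_axioms_def group_BijGroup)
qed

lemma gset_iso_nat:
  fixes S :: "('g, 's) gset"
  assumes "S \<in> finite_gsets G n"
  shows "\<exists>T :: ('g, nat) gset. T \<in> finite_gsets G n \<and> gset_iso G S T"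
proof -
  obtain A \<alpha> where S: "S = (A, \<alpha>)" and act: "group_action G A \<alpha>"
    and A: "finite A" "card A = n"
    using assms by (auto simp: finite_gsets_def)
  from A obtain f where f: "bij_betw f A {..<n}"
    by (metis ex_bij_betw_finite_nat atLeast0LessThan)
  define e where "e = inv_into A f"
  have e: "bij_betw e {..<n} A"
    using f by (simp add: e_def bij_betw_inv_into)
  have ef: "e (f s) = s" if "s \<in> A" for s
    using f that by (simp add: e_def bij_betw_inv_into_left)
  have eA: "e i \<in> A" if "i < n" for i
    using e that by (auto simp: bij_betw_def)
  have fN: "f s < n" if "s \<in> A" for s
    using f that by (auto simp: bij_betw_def)
  have aA: "\<alpha> g s \<in> A" if "g \<in> carrier G" "s \<in> A" for g s
    using group_action.element_image[OF act that] by simp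
  define \<beta> where "\<beta> g = (\<lambda>i \<in> {..<n}. f (\<alpha> g (e i)))" for g
  have "\<beta> g \<in> Bij {..<n}" if "g \<in> carrier G" for g
  proof -
    have "bij_betw (\<alpha> g) A A"
      using act that by (auto simp: group_action_iff Bij_def)
    then have "bij_betw (f \<circ> (\<alpha> g \<circ> e)) {..<n} {..<n}"
      using e f by (intro bij_betw_trans) auto
    moreover have "bij_betw (f \<circ> (\<alpha> g \<circ> e)) {..<n} {..<n} = bij_betw (\<beta> g) {..<n} {..<n}"
      by (rule bij_betw_cong) (simp add: \<beta>_def)
    ultimately show ?thesis
      by (simp add: Bij_def \<beta>_def)
  qed
  moreover have "\<beta> (g \<otimes>\<^bsub>G\<^esub> h) = compose {..<n} (\<beta> g) (\<beta> h)"
    if "g \<in> carrier G" "h \<in> carrier G" for g h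
    using act that by (auto simp: group_action_iff compose_def \<beta>_def fun_eq_iff eA fN aA ef)
  ultimately have "group_action G {..<n} \<beta>"
    using act by (auto simp: group_action_iff)
  then have "({..<n}, \<beta>) \<in> finite_gsets G n"
    by (simp add: finite_gsets_def)
  moreover have "gset_iso G S ({..<n}, \<beta>)"
    unfolding gset_iso_def S using f
    by (auto simp: equivariant_def \<beta>_def fN ef intro!: exI[of _ f])
  ultimately show ?thesis by blast
qed

lemma orbit_sum_in_finite_gsets:
  assumes G: "group G" "finite (carrier G)" and R: "\<And>c. c \<in> conj_classes G \<Longrightarrow> R c \<in> c"
  shows "orbit_sum G R k \<in> finite_gsets G (card (fst (orbit_sum G R k)))"
proof -
  interpret group G by fact
  define A where "A = {(c, i, C). c \<in> conj_classes G \<and> i < k c \<and> C \<in> lcosets\<^bsub>G\<^esub> (R c)}"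
  define \<alpha> where "\<alpha> = (\<lambda>g. \<lambda>(c, i, C) \<in> A. (c, i, g <#\<^bsub>G\<^esub> C))"
  have S: "orbit_sum G R k = (A, \<alpha>)"
    by (simp add: orbit_sum_def A_def \<alpha>_def Let_def)
  interpret conj: group_action G "{H. subgroup H G}" "conj_act G"
    unfolding conj_act_def by (rule action_by_conjugation_on_subgroups_set)
  have conj_sub: "c \<subseteq> {H. subgroup H G}" if "c \<in> conj_classes G" for c
    using that conj.element_image by (fastforce simp: conj_classes_def orbits_def orbit_def)
  have sub: "subgroup (R c) G" if "c \<in> conj_classes G" for c
    using conj_sub[OF that] R[OF that] by blast
  have sub': "R c \<subseteq> carrier G" if "c \<in> conj_classes G" for c
    using subgroup.subset[OF sub[OF that]] .
  have lc: "C \<subseteq> carrier G" if "c \<in> conj_classes G" "C \<in> lcosets\<^bsub>G\<^esub> (R c)" for c C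
    using subgroup.lcosets_carrier[OF sub[OF that(1)] G(1) that(2)] .
  have clos: "g <#\<^bsub>G\<^esub> C \<in> lcosets\<^bsub>G\<^esub> (R c)"
    if "c \<in> conj_classes G" "C \<in> lcosets\<^bsub>G\<^esub> (R c)" "g \<in> carrier G" for c C g
    using that sub'[OF that(1)] by (auto simp: LCOSETS_def lcos_m_assoc)
  have fin_classes: "finite (conj_classes G)"
  proof -
    have "conj_classes G \<subseteq> Pow (Pow (carrier G))"
      using conj_sub subgroup.subset by fastforce
    then show ?thesis by (rule finite_subset) (simp add: G)
  qed
  have fin: "finite A"
  proof (rule finite_subset)
    show "A \<subseteq> (SIGMA c : conj_classes G. {..<k c} \<times> Pow (carrier G))"
      using lc by (fastforce simp: A_def)
    show "finite (SIGMA c : conj_classes G. {..<k c} \<times> Pow (carrier G))"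
      using fin_classes G by blast
  qed
  have into: "\<alpha> g s \<in> A" if "g \<in> carrier G" "s \<in> A" for g s
    using that clos by (auto simp: \<alpha>_def A_def)
  have mult: "\<alpha> (g \<otimes>\<^bsub>G\<^esub> h) s = \<alpha> g (\<alpha> h s)"
    if "g \<in> carrier G" "h \<in> carrier G" "s \<in> A" for g h s
    using that clos lc by (auto simp: \<alpha>_def A_def lcos_m_assoc)
  have one: "\<alpha> \<one>\<^bsub>G\<^esub> s = s" if "s \<in> A" for s
    using that lc by (auto simp: \<alpha>_def A_def lcos_mult_one)
  have "\<alpha> g \<in> Bij A" if g: "g \<in> carrier G" for g
  proof -
    have "bij_betw (\<alpha> g) A A"
    proof (rule bij_betw_byWitness[where f' = "\<alpha> (inv\<^bsub>G\<^esub> g)"])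
      show "\<forall>s\<in>A. \<alpha> (inv\<^bsub>G\<^esub> g) (\<alpha> g s) = s"
        using g by (metis inv_closed mult one l_inv)
      show "\<forall>s\<in>A. \<alpha> g (\<alpha> (inv\<^bsub>G\<^esub> g) s) = s"
        using g by (metis inv_closed mult one r_inv)
    qed (use g into in auto)
    moreover have "\<alpha> g \<in> extensional A" by (simp add: \<alpha>_def)
    ultimately show ?thesis by (simp add: Bij_def)
  qed
  moreover have "\<alpha> (g \<otimes>\<^bsub>G\<^esub> h) = compose A (\<alpha> g) (\<alpha> h)"
    if "g \<in> carrier G" "h \<in> carrier G" for g h
  proof
    fix s show "\<alpha> (g \<otimes>\<^bsub>G\<^esub> h) s = compose A (\<alpha> g) (\<alpha> h) s"
      using mult[OF that] by (cases "s \<in> A") (simp_all add: compose_def, simp add: \<alpha>_def)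
  qed
  ultimately have "group_action G A \<alpha>"
    using G by (simp add: group_action_iff)
  with fin show ?thesis by (simp add: S finite_gsets_def)
qed

end

theory Submission
  imports Defs "HOL-Analysis.Abstract_Topological_Spaces"
begin

text \<open>
  A point of \<open>C\<^sub>n(X)\<^sup>G\<close> is an \<open>n\<close>-element \<open>G\<close>-invariant subset of \<open>X\<close>, hence itself a finite
  \<open>G\<close>-set, and a point of \<open>C\<^sub>S\<^sup>G(X)\<close> is an invariant subset isomorphic to \<open>S\<close>: two equivariant
  embeddings have the same image exactly when they differ by an isomorphism of their domains
  (\<open>gemb_equal_images\<close>). In the same way a point of \<open>\<Prod> C\<^bsub>k(c)\<^esub>(X\<^bsub>c\<^esub>/G)\<close> is an invariant subset, listed as
  its orbits sorted by stabilizer type. So on points both decompositions are immediate, and the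
  content of the theorem is that the topologies agree.

  Both comparison maps are induced on quotients by continuous maps out of \<open>Emb\<^sup>G(S, X)\<close>, so it is
  enough that these are open, have the right fibres (\<open>quotient_topology_induced_map\<close>) and jointly
  cover the target.
  Openness rests on one local fact, \<open>gemb_invariant_neighbourhoods\<close>: as \<open>X\<close> is Hausdorff and \<open>G\<close> is
  finite, the points \<open>f s\<close> of an equivariant embedding have arbitrarily small disjoint open
  neighbourhoods \<open>W s\<close> which \<open>G\<close> permutes in the way it permutes \<open>S\<close>.

  \<^item> For the first part, let an invariant set with \<open>|S|\<close> points have one point in each \<open>W s\<close>. A
    translate by \<open>g\<close> of its point in \<open>W s\<close> belongs to the set and lies in \<open>W (g s)\<close>, so it is the
    chosen point there: the set is automatically the image of an equivariant embedding close to \<open>f\<close>.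
    Thus each \<open>C\<^sub>S\<^sup>G(X)\<close> is embedded as an open subset of \<open>C\<^sub>n(X)\<^sup>G\<close> (\<open>gconf_open_embedding\<close>).

  \<^item> For the second part, let \<open>H\<close> be the stabilizer of \<open>s\<close>. A point of \<open>W s\<close> is moved off \<open>W s\<close>
    by every \<open>g \<notin> H\<close>, so its stabilizer is contained in \<open>H\<close>; if it is also conjugate to \<open>H\<close>, then it
    equals \<open>H\<close> because \<open>H\<close> is finite. Hence orbits of the right type near those of \<open>f\<close> contain points
    with the right stabilizers near the points of \<open>f\<close>, and these extend equivariantly to an
    embedding close to \<open>f\<close> (\<open>open_map_orbit_conf\<close>).
\<close>

section \<open>Quotients and separation\<close>

text \<open>
  The form of the universal property used for both homeomorphisms: openness is tested upstairs, on
  \<open>p\<close>, which avoids describing the open sets of the quotient.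
\<close>

lemma quotient_topology_induced_map:
  assumes cont: "continuous_map A B p" and opn: "open_map A B p"
    and fib: "\<And>x y. x \<in> topspace A \<Longrightarrow> y \<in> topspace A \<Longrightarrow> q x = q y \<longleftrightarrow> p x = p y"
  obtains h where "continuous_map (quotient_topology A q) B h"
    and "open_map (quotient_topology A q) B h"
    and "inj_on h (q ` topspace A)"
    and "\<And>x. x \<in> topspace A \<Longrightarrow> h (q x) = p x"
proof
  define h where "h = (\<lambda>c. p (inv_into (topspace A) q c))"
  note q = quotient_map_quotient_topology[of A q]
  show hq: "h (q x) = p x" if "x \<in> topspace A" for x
  proof -
    have "q (inv_into (topspace A) q (q x)) = q x"
      by (rule f_inv_into_f) (use that in blast)
    moreover have "inv_into (topspace A) q (q x) \<in> topspace A"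
      by (rule inv_into_into) (use that in blast)
    ultimately show ?thesis
      using fib that by (simp add: h_def)
  qed
  have "continuous_map A B (h \<circ> q)"
    using cont by (rule continuous_map_eq) (simp add: hq)
  then show "continuous_map (quotient_topology A q) B h"
    using continuous_compose_quotient_map_eq[OF q] by blast
  have "open_map A B (h \<circ> q)"
    using opn by (rule open_map_eq) (simp add: hq)
  then show "open_map (quotient_topology A q) B h"
    by (rule open_map_from_composition_left[OF _ quotient_imp_continuous_map[OF q]]) simp
  show "inj_on h (q ` topspace A)"
    by (auto simp: inj_on_def hq fib)
qed

text \<open>
  Each point is separated from every other one in both roles, left and right; intersecting the
  finitely many neighbourhoods of a point makes the family disjoint.
\<close>

lemma Hausdorff_space_separate_finite:
  assumes X: "Hausdorff_space X" and A: "finite A" and f: "f \<in> A \<rightarrow> topspace X" "inj_on f A"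
  obtains D where "\<And>s. s \<in> A \<Longrightarrow> openin X (D s)" and "\<And>s. s \<in> A \<Longrightarrow> f s \<in> D s"
    and "\<And>s t x. s \<in> A \<Longrightarrow> t \<in> A \<Longrightarrow> x \<in> D s \<Longrightarrow> x \<in> D t \<Longrightarrow> s = t"
proof -
  have "\<exists>P Q. openin X P \<and> openin X Q \<and> f s \<in> P \<and> f t \<in> Q \<and> disjnt P Q"
    if "s \<in> A" "t \<in> A" "s \<noteq> t" for s t
    using X f that unfolding Hausdorff_space_def inj_on_def Pi_iff by metis
  then obtain P Q where PQ: "\<And>s t. s \<in> A \<Longrightarrow> t \<in> A \<Longrightarrow> s \<noteq> t \<Longrightarrow>
      openin X (P s t) \<and> openin X (Q s t) \<and> f s \<in> P s t \<and> f t \<in> Q s t \<and> disjnt (P s t) (Q s t)"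
    by metis
  define D where "D s = topspace X \<inter> (\<Inter>t \<in> A - {s}. P s t \<inter> Q t s)" for s
  show thesis
  proof
    show "openin X (D s)" if "s \<in> A" for s
      unfolding D_def Int_commute[of "topspace X"]
      by (rule openin_INT) (use that PQ A in auto)
    show "f s \<in> D s" if "s \<in> A" for s
      using that PQ f by (auto simp: D_def)
    show "s = t" if st: "s \<in> A" "t \<in> A" and x: "x \<in> D s" "x \<in> D t" for s t x
    proof (rule ccontr)
      assume "s \<noteq> t"
      with st x have "x \<in> P s t" "x \<in> Q s t"
        by (auto simp: D_def)
      with PQ[OF st \<open>s \<noteq> t\<close>] show False
        by (auto simp: disjnt_iff)
    qed
  qed
qed

text \<open>
  A finite discrete space is compact, and an injective continuous map from a compact space to a
  Hausdorff space is an embedding.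
\<close>

lemma embedding_map_discrete_iff:
  assumes "Hausdorff_space X" and "finite A"
  shows "embedding_map (discrete_topology A) X f \<longleftrightarrow> f \<in> A \<rightarrow> topspace X \<and> inj_on f A"
proof
  assume "embedding_map (discrete_topology A) X f"
  then show "f \<in> A \<rightarrow> topspace X \<and> inj_on f A"
    unfolding embedding_map_def homeomorphic_eq_everything_map
    by (simp add: continuous_map_in_subtopology)
next
  assume f: "f \<in> A \<rightarrow> topspace X \<and> inj_on f A"
  then have c: "continuous_map (discrete_topology A) X f"
    by (simp add: continuous_map_from_discrete_topology)
  moreover have "closed_map (discrete_topology A) X f"
    using assms by (intro continuous_imp_closed_map_gen c Hausdorff_imp_kc_space)
      (simp_all add: compact_space_discrete_topology)
  ultimately show "embedding_map (discrete_topology A) X f"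
    using f by (intro injective_closed_imp_embedding_map) auto
qed

lemma open_map_from_basepoints:
  assumes "\<And>U x. openin A U \<Longrightarrow> x \<in> U \<Longrightarrow> \<exists>N. openin B N \<and> p x \<in> N \<and> N \<subseteq> p ` U"
  shows "open_map A B p"
  unfolding open_map_def
proof (intro allI impI)
  fix U assume U: "openin A U"
  show "openin B (p ` U)"
    by (subst openin_subopen) (use assms[OF U] in blast)
qed

lemma homeomorphic_space_sum_topologyI:
  assumes cont: "\<And>i. i \<in> I \<Longrightarrow> continuous_map (Z i) Y (h i)"
    and opn: "\<And>i. i \<in> I \<Longrightarrow> open_map (Z i) Y (h i)"
    and inj: "\<And>i. i \<in> I \<Longrightarrow> inj_on (h i) (topspace (Z i))"
    and disj: "\<And>i j x y. i \<in> I \<Longrightarrow> j \<in> I \<Longrightarrow> x \<in> topspace (Z i) \<Longrightarrow> y \<in> topspace (Z j) \<Longrightarrow>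
      h i x = h j y \<Longrightarrow> i = j"
    and cover: "topspace Y \<subseteq> (\<Union>i\<in>I. h i ` topspace (Z i))"
  shows "sum_topology Z I homeomorphic_space Y"
proof -
  let ?h = "\<lambda>(i, x). h i x"
  have into: "h i x \<in> topspace Y" if "i \<in> I" "x \<in> topspace (Z i)" for i x
    using continuous_map_image_subset_topspace[OF cont[OF that(1)]] that(2) by blast
  have "homeomorphic_map (sum_topology Z I) Y ?h"
  proof (rule bijective_open_imp_homeomorphic_map)
    show "continuous_map (sum_topology Z I) Y ?h"
      unfolding continuous_map openin_sum_topology
    proof (intro conjI allI impI ballI)
      show "?h ` topspace (sum_topology Z I) \<subseteq> topspace Y"
        using into by auto
      fix U i assume U: "openin Y U" and i: "i \<in> I"
      have "{x. (i, x) \<in> {z \<in> topspace (sum_topology Z I). ?h z \<in> U}}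
          = {x \<in> topspace (Z i). h i x \<in> U}"
        using i by auto
      then show "openin (Z i) {x. (i, x) \<in> {z \<in> topspace (sum_topology Z I). ?h z \<in> U}}"
        using openin_continuous_map_preimage[OF cont[OF i] U] by simp
    qed auto
    show "open_map (sum_topology Z I) Y ?h"
      unfolding open_map_def
    proof (intro allI impI)
      fix U assume U: "openin (sum_topology Z I) U"
      then have "?h ` U = (\<Union>i\<in>I. h i ` {x. (i, x) \<in> U})"
        by (force simp: openin_sum_topology)
      moreover have "openin Y (h i ` {x. (i, x) \<in> U})" if "i \<in> I" for i
        using opn[OF that] U that by (simp add: open_map_def openin_sum_topology)
      ultimately show "openin Y (?h ` U)"
        by auto
    qed
    show "?h ` topspace (sum_topology Z I) = topspace Y"
      using into cover by force
    show "inj_on ?h (topspace (sum_topology Z I))"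
    proof (rule inj_onI, clarsimp)
      fix i x j y
      assume ij: "i \<in> I" "x \<in> topspace (Z i)" "j \<in> I" "y \<in> topspace (Z j)" "h i x = h j y"
      then have "i = j" using disj by blast
      with ij show "i = j \<and> x = y" using inj_onD[OF inj] by blast
    qed
  qed
  then show ?thesis by (rule homeomorphic_map_imp_homeomorphic_space)
qed


section \<open>Unordered configurations as finite subsets\<close>

definition perm_class :: "nat \<Rightarrow> (nat \<Rightarrow> 'y) \<Rightarrow> (nat \<Rightarrow> 'y) set" where
  "perm_class n y = {y \<circ> \<sigma> | \<sigma>. \<sigma> permutes {..<n}}"

lemma conf_eq: "conf Y n = quotient_topology (ordered_conf Y n) (perm_class n)"
  by (simp add: conf_def perm_class_def[abs_def])

lemma topspace_ordered_conf:
  "topspace (ordered_conf Y n) = {y \<in> {..<n} \<rightarrow>\<^sub>E topspace Y. inj_on y {..<n}}"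
  by (auto simp: ordered_conf_def)

lemma topspace_conf: "topspace (conf Y n) = perm_class n ` topspace (ordered_conf Y n)"
  by (simp add: conf_eq)

lemma continuous_map_perm_class: "continuous_map (ordered_conf Y n) (conf Y n) (perm_class n)"
  unfolding conf_eq by (rule quotient_imp_continuous_map[OF quotient_map_quotient_topology])

lemma perm_class_refl: "y \<in> perm_class n y"
  unfolding perm_class_def by (rule CollectI, rule exI[of _ id]) (simp add: permutes_id)

lemma perm_class_image:
  assumes "z \<in> perm_class n y"
  shows "z ` {..<n} = y ` {..<n}"
proof -
  obtain \<sigma> where \<sigma>: "z = y \<circ> \<sigma>" "\<sigma> permutes {..<n}"
    using assms by (auto simp: perm_class_def)
  then show ?thesis
    by (simp only: image_comp[symmetric] permutes_image[OF \<sigma>(2)])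
qed

text \<open>
  Unordered configurations are thereby identified with finite subsets, which is how they are compared
  with images of embeddings below.
\<close>

lemma perm_class_eq_iff:
  assumes y: "y \<in> topspace (ordered_conf Y n)" and z: "z \<in> topspace (ordered_conf Y n)"
  shows "perm_class n y = perm_class n z \<longleftrightarrow> y ` {..<n} = z ` {..<n}"
proof
  assume "perm_class n y = perm_class n z"
  then show "y ` {..<n} = z ` {..<n}"
    using perm_class_refl perm_class_image by metis
next
  have sub: "perm_class n y \<subseteq> perm_class n z"
    if im: "y ` {..<n} = z ` {..<n}"
      and y: "y \<in> topspace (ordered_conf Y n)" and z: "z \<in> topspace (ordered_conf Y n)" for y z
  proof -
    have yb: "bij_betw y {..<n} (z ` {..<n})" and zb: "bij_betw z {..<n} (z ` {..<n})"
      using y z im by (auto simp: topspace_ordered_conf bij_betw_def)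
    \<comment> \<open>The identity outside \<open>{..<n}\<close>, where both \<open>y\<close> and \<open>z\<close> are undefined.\<close>
    define \<sigma> where "\<sigma> i = (if i < n then inv_into {..<n} z (y i) else i)" for i
    have "bij_betw (inv_into {..<n} z \<circ> y) {..<n} {..<n}"
      by (rule bij_betw_trans[OF yb bij_betw_inv_into[OF zb]])
    then have "bij_betw \<sigma> {..<n} {..<n}"
      by (rule bij_betw_cong[THEN iffD1, rotated]) (simp add: \<sigma>_def)
    then have \<sigma>: "\<sigma> permutes {..<n}"
      by (rule bij_imp_permutes) (simp add: \<sigma>_def)
    have "y i = z (\<sigma> i)" for i
    proof (cases "i < n")
      case True
      then have "y i \<in> z ` {..<n}" using im by blast
      then show ?thesis using True by (simp add: \<sigma>_def f_inv_into_f)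
    next
      case False
      then show ?thesis
        using y z by (auto simp: \<sigma>_def topspace_ordered_conf PiE_def extensional_def)
    qed
    then have "y = z \<circ> \<sigma>" by auto
    then show ?thesis
      using \<sigma> permutes_compose by (fastforce simp: perm_class_def comp_assoc)
  qed
  assume "y ` {..<n} = z ` {..<n}"
  then show "perm_class n y = perm_class n z"
    using sub[of y z] sub[of z y] y z by auto
qed

text \<open>
  These boxes are the only open sets of a configuration space that the openness proofs need. The
  saturation of a box is the union of the boxes with permuted sides.
\<close>

lemma openin_conf_box:
  assumes V: "\<And>i. i < n \<Longrightarrow> openin Y (V i)"
  shows "openin (conf Y n) (perm_class n ` {y \<in> topspace (ordered_conf Y n). \<forall>i<n. y i \<in> V i})"
proof -
  let ?B = "\<lambda>V. {y \<in> topspace (ordered_conf Y n). \<forall>i<n. y i \<in> V i}"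
  have box: "openin (ordered_conf Y n) (?B V)" if V: "\<And>i. i < n \<Longrightarrow> openin Y (V i)" for V
  proof -
    have "?B V = (\<Pi>\<^sub>E i\<in>{..<n}. V i) \<inter> {y. inj_on y {..<n}}"
      using openin_subset[OF V] by (auto simp: topspace_ordered_conf PiE_iff extensional_def)
    moreover have "openin (product_topology (\<lambda>_. Y) {..<n}) (\<Pi>\<^sub>E i\<in>{..<n}. V i)"
      using V by (simp add: openin_PiE_gen)
    ultimately show ?thesis
      using openin_subtopology_Int[of "product_topology (\<lambda>_. Y) {..<n}"]
      by (simp only: ordered_conf_def)
  qed
  have "{y \<in> topspace (ordered_conf Y n). perm_class n y \<in> perm_class n ` ?B V}
      = (\<Union>\<sigma> \<in> {\<sigma>. \<sigma> permutes {..<n}}. ?B (\<lambda>i. V (\<sigma> i)))" (is "?L = ?R")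
  proof
    show "?L \<subseteq> ?R"
    proof
      fix y assume "y \<in> ?L"
      then obtain z where y: "y \<in> topspace (ordered_conf Y n)" and z: "\<forall>i<n. z i \<in> V i"
        and "perm_class n y = perm_class n z" by blast
      then have "y \<in> perm_class n z"
        using perm_class_refl[of y n] by simp
      then obtain \<sigma> where "y = z \<circ> \<sigma>" and \<sigma>: "\<sigma> permutes {..<n}"
        unfolding perm_class_def by blast
      then have "\<forall>i<n. y i \<in> V (\<sigma> i)"
        using z permutes_in_image[OF \<sigma>] by auto
      with y \<sigma> show "y \<in> ?R" by blast
    qed
    show "?R \<subseteq> ?L"
    proof
      fix y assume "y \<in> ?R"
      then obtain \<sigma> where y: "y \<in> topspace (ordered_conf Y n)" and \<sigma>: "\<sigma> permutes {..<n}"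
        and yV: "\<forall>i<n. y i \<in> V (\<sigma> i)" by blast
      note \<sigma>' = permutes_inv[OF \<sigma>]
      define z where "z = y \<circ> inv_into UNIV \<sigma>"
      have z_image: "z ` {..<n} = y ` {..<n}"
        by (rule perm_class_image) (use \<sigma>' in \<open>auto simp: perm_class_def z_def\<close>)
      have zV: "z i \<in> V i" if "i < n" for i
        using yV[rule_format, of "inv_into UNIV \<sigma> i"] that permutes_in_image[OF \<sigma>', of i]
        by (simp add: z_def permutes_inverses[OF \<sigma>])
      have "inj_on z {..<n}"
        unfolding z_def using y
        by (intro comp_inj_on) (auto simp: permutes_image[OF \<sigma>'] topspace_ordered_conf
            permutes_inj_on[OF \<sigma>'])
      moreover have "z \<in> {..<n} \<rightarrow>\<^sub>E topspace Y"
      proof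
        show "z i \<in> topspace Y" if "i \<in> {..<n}" for i
          using zV[of i] V[of i] that openin_subset by fastforce
        show "z i = undefined" if "i \<notin> {..<n}" for i
          using that y permutes_not_in[OF \<sigma>' that]
          by (auto simp: z_def topspace_ordered_conf PiE_def extensional_def)
      qed
      ultimately have z: "z \<in> topspace (ordered_conf Y n)"
        by (simp add: topspace_ordered_conf)
      then have "perm_class n y = perm_class n z"
        using perm_class_eq_iff[OF y z] z_image by simp
      with y z zV show "y \<in> ?L" by blast
    qed
  qed
  moreover have "openin (ordered_conf Y n) (?B (\<lambda>i. V (\<sigma> i)))" if "\<sigma> permutes {..<n}" for \<sigma>
    using permutes_in_image[OF that] by (intro box V) auto
  ultimately show ?thesis
    unfolding conf_eq openin_quotient_topology by (auto intro!: openin_Union)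
qed

lemma conf_act_perm_class:
  fixes y :: "nat \<Rightarrow> 'x"
  shows "conf_act \<phi> n g (perm_class n y) = perm_class n (\<lambda>i \<in> {..<n}. \<phi> g (y i))"
proof -
  have pc: "perm_class n z = (\<lambda>\<sigma>. z \<circ> \<sigma>) ` {\<sigma>. \<sigma> permutes {..<n}}" for z :: "nat \<Rightarrow> 'x"
    by (auto simp: perm_class_def)
  show ?thesis
    unfolding conf_act_def pc image_image
  proof (rule image_cong[OF refl])
    fix \<sigma> assume "\<sigma> \<in> {\<sigma>. \<sigma> permutes {..<n}}"
    then have "\<sigma> permutes {..<n}" by simp
    then show "(\<lambda>i \<in> {..<n}. \<phi> g ((y \<circ> \<sigma>) i)) = (\<lambda>i \<in> {..<n}. \<phi> g (y i)) \<circ> \<sigma>"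
      using permutes_in_image[of \<sigma> "{..<n}"] by (auto simp: fun_eq_iff restrict_def)
  qed
qed


section \<open>Group actions and finite G-sets\<close>

context group_action
begin

sublocale group G
  using group_hom by (simp add: group_hom_def)

lemma orbit_eq_iff:
  assumes "x \<in> E" "y \<in> E"
  shows "orbit G \<phi> x = orbit G \<phi> y \<longleftrightarrow> y \<in> orbit G \<phi> x"
proof
  have sub: "orbit G \<phi> y \<subseteq> orbit G \<phi> x" if "x \<in> E" "y \<in> E" "y \<in> orbit G \<phi> x" for x y
  proof
    fix z assume z: "z \<in> orbit G \<phi> y"
    then have "z \<in> E"
      using element_image that(2) unfolding orbit_def by blast
    then show "z \<in> orbit G \<phi> x"
      using orbit_trans that z by blast
  qed
  show "y \<in> orbit G \<phi> x" if "orbit G \<phi> x = orbit G \<phi> y"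
    using that orbit_refl[OF assms(2)] by simp
  show "orbit G \<phi> x = orbit G \<phi> y" if "y \<in> orbit G \<phi> x"
    using sub[OF assms that] sub[OF assms(2,1) orbit_sym[OF assms that]] by auto
qed

lemma act_closed: "g \<in> carrier G \<Longrightarrow> x \<in> E \<Longrightarrow> \<phi> g x \<in> E"
  by (simp add: element_image)

lemma act_one: "x \<in> E \<Longrightarrow> \<phi> \<one> x = x"
  using fun_cong[OF id_eq_one, of x] by simp

lemma act_inv:
  assumes "g \<in> carrier G" "x \<in> E"
  shows "\<phi> (inv g) (\<phi> g x) = x"
  using assms by (simp add: composition_rule[symmetric] act_one)

lemma orbit_act:
  assumes "g \<in> carrier G" "x \<in> E"
  shows "orbit G \<phi> (\<phi> g x) = orbit G \<phi> x"
  using orbit_eq_iff[of x "\<phi> g x"] assms act_closed by (auto simp: orbit_def)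

lemma invariant_subset_gset:
  assumes F: "F \<subseteq> E" "finite F"
    and inv: "\<And>g x. g \<in> carrier G \<Longrightarrow> x \<in> F \<Longrightarrow> \<phi> g x \<in> F"
  shows "(F, \<lambda>g. restrict (\<phi> g) F) \<in> finite_gsets G (card F)"
proof -
  have "restrict (\<phi> g) F \<in> Bij F" if g: "g \<in> carrier G" for g
  proof -
    have inj: "inj_on (\<phi> g) F"
      using inj_prop[OF g] F(1) by (rule inj_on_subset)
    then have "\<phi> g ` F = F"
      using inv[OF g] F(2) by (intro endo_inj_surj) auto
    with inj show ?thesis by (simp add: Bij_def bij_betw_def inj_on_def)
  qed
  moreover have "restrict (\<phi> (g \<otimes> h)) F = compose F (restrict (\<phi> g) F) (restrict (\<phi> h) F)"
    if "g \<in> carrier G" "h \<in> carrier G" for g h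
    using that F(1) inv composition_rule by (auto simp: compose_def fun_eq_iff)
  ultimately have "group_action G F (\<lambda>g. restrict (\<phi> g) F)"
    using group_axioms by (simp add: group_action_iff)
  then show ?thesis using F(2) by (simp add: finite_gsets_def)
qed

end

lemma gset_iso_sym:
  assumes "S \<in> finite_gsets G n" and iso: "gset_iso G S T"
  shows "gset_iso G T S"
proof -
  obtain A \<alpha> B \<beta> where ST: "S = (A, \<alpha>)" "T = (B, \<beta>)" by fastforce
  interpret A: group_action G A \<alpha> using assms ST by (simp add: finite_gsets_def)
  obtain f where f: "bij_betw f A B" "equivariant G A \<alpha> \<beta> f"
    using iso by (auto simp: gset_iso_def ST)
  have "equivariant G B \<beta> \<alpha> (inv_into A f)"
    unfolding equivariant_def
  proof (intro ballI)
    fix g t assume g: "g \<in> carrier G" and t: "t \<in> B"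
    define s where "s = inv_into A f t"
    have s: "s \<in> A" "f s = t"
      using f(1) t by (auto simp: s_def bij_betw_def intro: inv_into_into f_inv_into_f)
    have "inv_into A f (f (\<alpha> g s)) = \<alpha> g s"
      using f(1) A.element_image[OF g s(1) refl] by (rule bij_betw_inv_into_left)
    then show "inv_into A f (\<beta> g t) = \<alpha> g (inv_into A f t)"
      using f(2) g s by (simp add: equivariant_def s_def)
  qed
  then show ?thesis
    using bij_betw_inv_into[OF f(1)] unfolding gset_iso_def ST by auto
qed

lemma gset_iso_trans:
  assumes "gset_iso G S T" "gset_iso G T U"
  shows "gset_iso G S U"
proof -
  obtain f h where f: "bij_betw f (fst S) (fst T)" "equivariant G (fst S) (snd S) (snd T) f"
    and h: "bij_betw h (fst T) (fst U)" "equivariant G (fst T) (snd T) (snd U) h"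
    using assms by (auto simp: gset_iso_def)
  have "f s \<in> fst T" if "s \<in> fst S" for s
    using f(1) that by (auto simp: bij_betw_def)
  then have "equivariant G (fst S) (snd S) (snd U) (h \<circ> f)"
    using f(2) h(2) by (simp add: equivariant_def)
  then show ?thesis
    using bij_betw_trans[OF f(1) h(1)] unfolding gset_iso_def by blast
qed

lemma equiv_gset_iso:
  fixes G :: "('g, 'm) monoid_scheme"
  shows "equiv (finite_gsets G n)
    {(S, T). S \<in> finite_gsets G n \<and> T \<in> finite_gsets G n \<and> gset_iso G S T}"
proof (rule equivI)
  have "gset_iso G S S" for S :: "('g, 's) gset"
    unfolding gset_iso_def by (rule exI[of _ id]) (simp add: equivariant_def)
  then show "refl_on (finite_gsets G n)
      {(S, T). S \<in> finite_gsets G n \<and> T \<in> finite_gsets G n \<and> gset_iso G S T}"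
    by (auto simp: refl_on_def)
qed (auto simp: sym_def trans_def intro: gset_iso_sym gset_iso_trans)


section \<open>Equivariant embeddings\<close>

definition aut_class ::
  "('g, 'm) monoid_scheme \<Rightarrow> ('g, 's) gset \<Rightarrow> ('s \<Rightarrow> 'x) \<Rightarrow> ('s \<Rightarrow> 'x) set" where
  "aut_class G S f = {compose (fst S) f a | a. a \<in> gset_aut G S}"

lemma gconf_eq: "gconf G S X \<phi> = quotient_topology (gemb G S X \<phi>) (aut_class G S)"
  by (simp add: gconf_def aut_class_def[abs_def])

locale Hausdorff_G_space = group_action G "topspace X" \<phi>
  for G :: "('g, 'm) monoid_scheme" (structure) and X :: "'x topology" and \<phi> +
  assumes finite_G: "finite (carrier G)"
    and continuous_act: "\<And>g. g \<in> carrier G \<Longrightarrow> continuous_map X X (\<phi> g)"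
    and Hausdorff: "Hausdorff_space X"
begin

lemma topspace_gemb:
  assumes "S \<in> finite_gsets G n"
  shows "topspace (gemb G S X \<phi>) =
    {f \<in> fst S \<rightarrow>\<^sub>E topspace X. inj_on f (fst S) \<and> equivariant G (fst S) (snd S) \<phi> f}"
  using assms embedding_map_discrete_iff[OF Hausdorff, of "fst S"]
  by (auto simp: gemb_def finite_gsets_def)

text \<open>
  The isomorphism \<open>h\<^sup>-\<^sup>1 \<circ> f\<close> is equivariant because \<open>f\<close> and \<open>h\<close> are and \<open>h\<close> is injective. With \<open>S = T\<close>
  this computes the fibres of \<open>Emb\<^sup>G(S, X) \<rightarrow> C\<^sub>S\<^sup>G(X)\<close>; with \<open>S\<close> and \<open>T\<close> different it shows that the
  pieces of the decomposition are disjoint.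
\<close>

lemma gemb_equal_images:
  assumes S: "S \<in> finite_gsets G n" and T: "T \<in> finite_gsets G m"
    and f: "f \<in> topspace (gemb G S X \<phi>)" and h: "h \<in> topspace (gemb G T X \<phi>)"
    and im: "f ` fst S = h ` fst T"
  obtains a where "bij_betw a (fst S) (fst T)" "equivariant G (fst S) (snd S) (snd T) a"
    "a \<in> extensional (fst S)" "f = compose (fst S) h a"
proof -
  obtain A \<alpha> B \<beta> where ST: "S = (A, \<alpha>)" "T = (B, \<beta>)" by fastforce
  define a where "a = (\<lambda>s \<in> A. inv_into B h (f s))"
  interpret A: group_action G A \<alpha> using S ST by (simp add: finite_gsets_def)
  interpret B: group_action G B \<beta> using T ST by (simp add: finite_gsets_def)
  note f' = f[unfolded topspace_gemb[OF S], unfolded ST fst_conv snd_conv mem_Collect_eq]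
  note h' = h[unfolded topspace_gemb[OF T], unfolded ST fst_conv snd_conv mem_Collect_eq]
  have ha: "h (a s) = f s" and aB: "a s \<in> B" if "s \<in> A" for s
    using im that by (auto simp: a_def ST intro!: f_inv_into_f inv_into_into)
  have "bij_betw (inv_into B h \<circ> f) A B"
    using f' h' im by (intro bij_betw_trans[of f A "h ` B"] bij_betw_inv_into)
      (auto simp: bij_betw_def ST)
  then have bij: "bij_betw a A B"
    by (rule bij_betw_cong[THEN iffD1, rotated]) (simp add: a_def)
  have "equivariant G A \<alpha> \<beta> a"
    unfolding equivariant_def
  proof (intro ballI)
    fix g s assume g: "g \<in> carrier G" and s: "s \<in> A"
    have gs: "\<alpha> g s \<in> A" by (rule A.element_image[OF g s refl])
    have gas: "\<beta> g (a s) \<in> B" by (rule B.element_image[OF g aB[OF s] refl])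
    have "h (a (\<alpha> g s)) = h (\<beta> g (a s))"
      using f' h' g s gs by (simp add: ha aB equivariant_def)
    then show "a (\<alpha> g s) = \<beta> g (a s)"
      using h' aB[OF gs] gas by (blast dest: inj_onD)
  qed
  moreover have "a \<in> extensional A" by (simp add: a_def)
  moreover have "f = compose A h a"
    using f' ha by (auto simp: compose_def fun_eq_iff PiE_def extensional_def)
  ultimately show thesis
    using that[unfolded ST fst_conv snd_conv] bij by blast
qed

lemma aut_class_eq_iff:
  assumes S: "S \<in> finite_gsets G n"
    and f: "f \<in> topspace (gemb G S X \<phi>)" and h: "h \<in> topspace (gemb G S X \<phi>)"
  shows "aut_class G S f = aut_class G S h \<longleftrightarrow> f ` fst S = h ` fst S"
proof
  obtain A \<alpha> where ST: "S = (A, \<alpha>)" by fastforce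
  interpret A: group_action G A \<alpha> using S ST by (simp add: finite_gsets_def)
  assume eq: "aut_class G S f = aut_class G S h"
  have "(\<lambda>s\<in>A. s) \<in> gset_aut G S"
    using A.element_image by (auto simp: gset_aut_def Bij_def equivariant_def ST bij_betw_def)
  moreover have "f = compose A f (\<lambda>s\<in>A. s)"
    using f[unfolded topspace_gemb[OF S]]
    by (auto simp: ST fun_eq_iff compose_def PiE_def extensional_def)
  ultimately have "f \<in> aut_class G S f"
    by (auto simp: aut_class_def ST)
  then obtain a where a: "a \<in> gset_aut G S" and fa: "f = compose A h a"
    unfolding eq by (auto simp: aut_class_def ST)
  from a have "a ` A = A"
    by (auto simp: gset_aut_def Bij_def bij_betw_def ST)
  moreover have "f ` A = h ` a ` A"
    by (auto simp: fa compose_def)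
  ultimately show "f ` fst S = h ` fst S"
    by (simp add: ST)
next
  have sub: "aut_class G S f \<subseteq> aut_class G S h"
    if f: "f \<in> topspace (gemb G S X \<phi>)" and h: "h \<in> topspace (gemb G S X \<phi>)"
      and im: "f ` fst S = h ` fst S" for f h
  proof -
    obtain A \<alpha> where ST: "S = (A, \<alpha>)" by fastforce
    obtain a where a: "bij_betw a A A" "equivariant G A \<alpha> \<alpha> a" "a \<in> extensional A"
      and fa: "f = compose A h a"
      using gemb_equal_images[OF S S f h im] by (auto simp: ST)
    have "compose A f b \<in> aut_class G S h" if b: "b \<in> gset_aut G S" for b
    proof -
      have "b \<in> A \<rightarrow> A" using b by (auto simp: gset_aut_def Bij_def bij_betw_def ST)
      then have "compose A f b = compose A h (compose A a b)"
        by (auto simp: fa compose_def fun_eq_iff)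
      moreover have "compose A a b \<in> gset_aut G S"
        using a b \<open>b \<in> A \<rightarrow> A\<close> group_action.element_image[of G A \<alpha>] S
        by (auto simp: gset_aut_def ST equivariant_def compose_eq finite_gsets_def Bij_def
            intro: bij_betw_compose)
      ultimately show ?thesis by (auto simp: aut_class_def ST)
    qed
    then show ?thesis by (auto simp: aut_class_def ST)
  qed
  assume "f ` fst S = h ` fst S"
  then show "aut_class G S f = aut_class G S h"
    using sub[OF f h] sub[OF h f] by simp
qed

text \<open>
  Start with a box \<open>B\<close> around \<open>f\<close> inside \<open>U\<close> and with disjoint neighbourhoods \<open>D s\<close> of the points
  \<open>f s\<close>. A point is kept in \<open>W s\<close> if each of its translates by \<open>g\<close> is in the sets belonging to
  \<open>g s\<close>. This is open since \<open>G\<close> is finite, contains \<open>f s\<close> since \<open>f\<close> is equivariant, and makes the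
  family \<open>W\<close> equivariant.
\<close>

lemma gemb_invariant_neighbourhoods:
  assumes S: "(A, \<alpha>) \<in> finite_gsets G n"
    and U: "openin (gemb G (A, \<alpha>) X \<phi>) U" and f: "f \<in> U"
  obtains W where "\<And>s. s \<in> A \<Longrightarrow> openin X (W s)" and "\<And>s. s \<in> A \<Longrightarrow> f s \<in> W s"
    and "\<And>s t x. s \<in> A \<Longrightarrow> t \<in> A \<Longrightarrow> x \<in> W s \<Longrightarrow> x \<in> W t \<Longrightarrow> s = t"
    and "\<And>g s x. g \<in> carrier G \<Longrightarrow> s \<in> A \<Longrightarrow> x \<in> W s \<Longrightarrow> \<phi> g x \<in> W (\<alpha> g s)"
    and "\<And>h. h \<in> topspace (gemb G (A, \<alpha>) X \<phi>) \<Longrightarrow> \<forall>s \<in> A. h s \<in> W s \<Longrightarrow> h \<in> U"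
proof -
  interpret A: group_action G A \<alpha> using S by (simp add: finite_gsets_def)
  have finA: "finite A" using S by (simp add: finite_gsets_def)
  have ft: "f \<in> topspace (gemb G (A, \<alpha>) X \<phi>)" using U f openin_subset by blast
  note f' = ft[unfolded topspace_gemb[OF S] fst_conv snd_conv mem_Collect_eq]
  obtain O' where O': "openin (product_topology (\<lambda>_. X) A) O'"
    and UO: "U = O' \<inter> {f. embedding_map (discrete_topology A) X f \<and> equivariant G A \<alpha> \<phi> f}"
    using U unfolding gemb_def openin_subtopology fst_conv snd_conv by blast
  have "f \<in> O'" using f UO by blast
  then obtain B where B: "\<And>s. s \<in> A \<Longrightarrow> openin X (B s)" and fB: "f \<in> Pi\<^sub>E A B"
    and BO: "Pi\<^sub>E A B \<subseteq> O'"
    using O' unfolding openin_product_topology_alt by meson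
  have fi: "f \<in> A \<rightarrow> topspace X" "inj_on f A" using f' by auto
  obtain D where D: "\<And>s. s \<in> A \<Longrightarrow> openin X (D s)" "\<And>s. s \<in> A \<Longrightarrow> f s \<in> D s"
    "\<And>s t x. s \<in> A \<Longrightarrow> t \<in> A \<Longrightarrow> x \<in> D s \<Longrightarrow> x \<in> D t \<Longrightarrow> s = t"
    using Hausdorff_space_separate_finite[OF Hausdorff finA fi] by metis
  define W where "W s = (\<Inter>g \<in> carrier G. {x \<in> topspace X. \<phi> g x \<in> B (\<alpha> g s) \<inter> D (\<alpha> g s)})" for s
  have A1: "\<alpha> g s \<in> A" if "g \<in> carrier G" "s \<in> A" for g s
    by (rule A.element_image[OF that refl])
  have Aone: "\<alpha> \<one> s = s" if "s \<in> A" for s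
    using fun_cong[OF A.id_eq_one, of s] that by simp
  have WBD: "x \<in> B s \<inter> D s" if "x \<in> W s" "s \<in> A" for x s
  proof -
    have "x \<in> topspace X \<and> \<phi> \<one> x \<in> B (\<alpha> \<one> s) \<inter> D (\<alpha> \<one> s)"
      using that(1) unfolding W_def by blast
    then show ?thesis using that(2) act_one[of x] by (simp add: Aone)
  qed
  show thesis
  proof (rule that[of W])
    show "openin X (W s)" if "s \<in> A" for s
      unfolding W_def
    proof (rule openin_INT2)
      show "finite (carrier G)" by (rule finite_G)
      show "carrier G \<noteq> {}" using one_closed by blast
      show "openin X {x \<in> topspace X. \<phi> g x \<in> B (\<alpha> g s) \<inter> D (\<alpha> g s)}" if g: "g \<in> carrier G" for g
        by (rule openin_continuous_map_preimage[OF continuous_act[OF g]])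
          (use A1[OF g \<open>s \<in> A\<close>] B D(1) in auto)
    qed
    show "f s \<in> W s" if s: "s \<in> A" for s
    proof -
      have "\<phi> g (f s) = f (\<alpha> g s)" if "g \<in> carrier G" for g
        using f' s that by (simp add: equivariant_def)
      then show ?thesis
        using s fi fB D(2) A1 by (auto simp: W_def)
    qed
    show "s = t" if "s \<in> A" "t \<in> A" "x \<in> W s" "x \<in> W t" for s t x
      using WBD D(3) that by blast
    show "\<phi> g x \<in> W (\<alpha> g s)" if g: "g \<in> carrier G" and s: "s \<in> A" and x: "x \<in> W s" for g s x
    proof -
      have xX: "x \<in> topspace X" using x one_closed by (auto simp: W_def)
      have "\<phi> h (\<phi> g x) \<in> B (\<alpha> h (\<alpha> g s)) \<inter> D (\<alpha> h (\<alpha> g s))" if h: "h \<in> carrier G" for h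
        using x m_closed[OF h g] composition_rule[OF xX h g] A.composition_rule[OF s h g]
        unfolding W_def by fastforce
      then show ?thesis
        using act_closed[OF g xX] by (simp add: W_def)
    qed
    show "h \<in> U" if "h \<in> topspace (gemb G (A, \<alpha>) X \<phi>)" "\<forall>s \<in> A. h s \<in> W s" for h
    proof -
      have "h \<in> Pi\<^sub>E A B"
        using that topspace_gemb[OF S] WBD by (auto simp: PiE_iff)
      then show ?thesis using UO BO that(1) by (auto simp: gemb_def)
    qed
  qed
qed


section \<open>Fixed configurations\<close>

text \<open>
  Fixed configurations are the invariant subsets. Mapping the finite set into itself suffices, as
  translations are injective.
\<close>

lemma perm_class_fixed_iff:
  assumes y: "y \<in> topspace (ordered_conf X n)"
  shows "perm_class n y \<in> topspace (conf_fixed G \<phi> X n) \<longleftrightarrow>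
    (\<forall>g \<in> carrier G. \<forall>i<n. \<phi> g (y i) \<in> y ` {..<n})"
proof -
  have "conf_act \<phi> n g (perm_class n y) = perm_class n y \<longleftrightarrow> (\<forall>i<n. \<phi> g (y i) \<in> y ` {..<n})"
    if g: "g \<in> carrier G" for g
  proof -
    have yX: "y ` {..<n} \<subseteq> topspace X" and "inj_on y {..<n}"
      using y by (auto simp: topspace_ordered_conf)
    moreover have inj: "inj_on (\<phi> g) (y ` {..<n})"
      using inj_prop[OF g] yX by (rule inj_on_subset)
    ultimately have "inj_on (\<lambda>i. \<phi> g (y i)) {..<n}"
      by (simp add: inj_on_def)
    then have gy: "(\<lambda>i \<in> {..<n}. \<phi> g (y i)) \<in> topspace (ordered_conf X n)"
      using yX act_closed[OF g] by (auto simp: topspace_ordered_conf inj_on_def)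
    have "conf_act \<phi> n g (perm_class n y) = perm_class n y \<longleftrightarrow> \<phi> g ` y ` {..<n} = y ` {..<n}"
      unfolding conf_act_perm_class perm_class_eq_iff[OF gy y] by (simp add: image_comp comp_def)
    also have "\<dots> \<longleftrightarrow> \<phi> g ` y ` {..<n} \<subseteq> y ` {..<n}"
      using endo_inj_surj[OF _ _ inj] by auto
    finally show ?thesis by auto
  qed
  then show ?thesis
    using y by (auto simp: conf_fixed_def topspace_conf)
qed

text \<open>
  The map is induced by \<open>f \<mapsto> f \<circ> e\<close> for a numbering \<open>e\<close> of \<open>A\<close>. Its image is described through subsets
  of \<open>X\<close>, so that the images for different \<open>G\<close>-sets can be compared.
\<close>

lemma gconf_open_embedding:
  fixes A :: "'s set"
  assumes S: "(A, \<alpha>) \<in> finite_gsets G n"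
  shows "\<exists>h. continuous_map (gconf G (A, \<alpha>) X \<phi>) (conf_fixed G \<phi> X n) h \<and>
    open_map (gconf G (A, \<alpha>) X \<phi>) (conf_fixed G \<phi> X n) h \<and>
    inj_on h (topspace (gconf G (A, \<alpha>) X \<phi>)) \<and>
    (\<forall>y \<in> topspace (ordered_conf X n).
      perm_class n y \<in> h ` topspace (gconf G (A, \<alpha>) X \<phi>) \<longleftrightarrow>
      (\<exists>f \<in> topspace (gemb G (A, \<alpha>) X \<phi>). f ` A = y ` {..<n}))"
proof -
  interpret A: group_action G A \<alpha> using S by (simp add: finite_gsets_def)
  have A1: "\<alpha> g s \<in> A" if "g \<in> carrier G" "s \<in> A" for g s
    by (rule A.element_image[OF that refl])
  obtain e where e: "bij_betw e {..<n} A"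
    using S ex_bij_betw_nat_finite[of A] by (auto simp: finite_gsets_def atLeast0LessThan)
  have eA: "e i \<in> A" if "i < n" for i
    using e that by (auto simp: bij_betw_def)
  define d where "d = inv_into {..<n} e"
  have d: "bij_betw d A {..<n}"
    using e by (simp add: d_def bij_betw_inv_into)
  have de: "d (e i) = i" if "i < n" for i
    using e that by (simp add: d_def bij_betw_inv_into_left)
  have ed: "e (d s) = s" if "s \<in> A" for s
    using e that by (simp add: d_def bij_betw_inv_into_right)
  have dn: "d s < n" if "s \<in> A" for s
    using d that by (auto simp: bij_betw_def)
  note gembD = topspace_gemb[OF S, unfolded fst_conv snd_conv]
  define y where "y f = (\<lambda>i \<in> {..<n}. f (e i))" for f :: "'s \<Rightarrow> 'x"
  have y_oc: "y f \<in> topspace (ordered_conf X n)"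
    and y_im: "y f ` {..<n} = f ` A"
    and y_fix: "perm_class n (y f) \<in> topspace (conf_fixed G \<phi> X n)"
    if f: "f \<in> topspace (gemb G (A, \<alpha>) X \<phi>)" for f
  proof -
    have f': "f \<in> A \<rightarrow>\<^sub>E topspace X" "inj_on f A" "equivariant G A \<alpha> \<phi> f"
      using f gembD by auto
    have "inj_on (f \<circ> e) {..<n}"
      using e f'(2) by (intro comp_inj_on) (auto simp: bij_betw_def)
    then show oc: "y f \<in> topspace (ordered_conf X n)"
      using f'(1) eA by (auto simp: topspace_ordered_conf y_def inj_on_def)
    have "y f ` {..<n} = f ` e ` {..<n}"
      by (auto simp: y_def)
    then show im: "y f ` {..<n} = f ` A"
      using e by (simp add: bij_betw_def)
    have "\<phi> g (y f i) \<in> y f ` {..<n}" if "g \<in> carrier G" "i < n" for g i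
      using f'(3) that eA[OF that(2)] A1 unfolding im by (force simp: y_def equivariant_def)
    then show "perm_class n (y f) \<in> topspace (conf_fixed G \<phi> X n)"
      using perm_class_fixed_iff[OF oc] by blast
  qed
  have "continuous_map (gemb G (A, \<alpha>) X \<phi>) (product_topology (\<lambda>_. X) {..<n}) y"
    unfolding continuous_map_componentwise
  proof (intro conjI ballI)
    fix i assume i: "i \<in> {..<n}"
    have "continuous_map (gemb G (A, \<alpha>) X \<phi>) X (\<lambda>f. f (e i))"
      unfolding gemb_def fst_conv
      using eA i by (intro continuous_map_from_subtopology continuous_map_product_projection) auto
    then show "continuous_map (gemb G (A, \<alpha>) X \<phi>) X (\<lambda>f. y f i)"
      using i by (simp add: y_def)
  qed (auto simp: y_def)
  then have "continuous_map (gemb G (A, \<alpha>) X \<phi>) (ordered_conf X n) y"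
    using y_oc unfolding ordered_conf_def continuous_map_in_subtopology by (auto simp: ordered_conf_def)
  then have cont: "continuous_map (gemb G (A, \<alpha>) X \<phi>) (conf_fixed G \<phi> X n) (perm_class n \<circ> y)"
    using continuous_map_compose[OF _ continuous_map_perm_class] y_fix
    unfolding conf_fixed_def continuous_map_in_subtopology by (auto simp: conf_fixed_def)
  have opn: "open_map (gemb G (A, \<alpha>) X \<phi>) (conf_fixed G \<phi> X n) (perm_class n \<circ> y)"
  proof (rule open_map_from_basepoints)
    fix U f assume U: "openin (gemb G (A, \<alpha>) X \<phi>) U" and fU: "f \<in> U"
    have f: "f \<in> topspace (gemb G (A, \<alpha>) X \<phi>)" using U fU openin_subset by blast
    obtain W where W: "\<And>s. s \<in> A \<Longrightarrow> openin X (W s)" "\<And>s. s \<in> A \<Longrightarrow> f s \<in> W s"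
      and disj: "\<And>s t x. s \<in> A \<Longrightarrow> t \<in> A \<Longrightarrow> x \<in> W s \<Longrightarrow> x \<in> W t \<Longrightarrow> s = t"
      and act: "\<And>g s x. g \<in> carrier G \<Longrightarrow> s \<in> A \<Longrightarrow> x \<in> W s \<Longrightarrow> \<phi> g x \<in> W (\<alpha> g s)"
      and WU: "\<And>h. h \<in> topspace (gemb G (A, \<alpha>) X \<phi>) \<Longrightarrow> \<forall>s \<in> A. h s \<in> W s \<Longrightarrow> h \<in> U"
      by (rule gemb_invariant_neighbourhoods[OF S U fU]) blast
    define B where "B = {z \<in> topspace (ordered_conf X n). \<forall>i<n. z i \<in> W (e i)}"
    define N where "N = perm_class n ` B \<inter> topspace (conf_fixed G \<phi> X n)"
    have B: "openin (conf X n) (perm_class n ` B)"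
      unfolding B_def by (rule openin_conf_box) (simp add: W eA)
    have "N = perm_class n ` B \<inter> {c. \<forall>g \<in> carrier G. conf_act \<phi> n g c = c}"
      using openin_subset[OF B] by (auto simp: N_def conf_fixed_def)
    then have "openin (conf_fixed G \<phi> X n) N"
      unfolding conf_fixed_def using B by (simp add: openin_subtopology_Int)
    moreover have "(perm_class n \<circ> y) f \<in> N"
      using y_oc[OF f] y_fix[OF f] W eA by (auto simp: N_def B_def y_def)
    moreover have "N \<subseteq> (perm_class n \<circ> y) ` U"
    proof
      fix c assume "c \<in> N"
      then obtain z where z: "z \<in> topspace (ordered_conf X n)" and zW: "\<And>i. i < n \<Longrightarrow> z i \<in> W (e i)"
        and c: "c = perm_class n z" and fixd: "perm_class n z \<in> topspace (conf_fixed G \<phi> X n)"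
        by (auto simp: N_def B_def)
      \<comment> \<open>\<open>h s\<close> is the only point of the configuration in \<open>W s\<close>; this forces \<open>h\<close> to be equivariant.\<close>
      define h where "h = (\<lambda>s \<in> A. z (d s))"
      have hW: "h s \<in> W s" if "s \<in> A" for s
        using zW[OF dn[OF that]] that by (simp add: h_def ed)
      have "equivariant G A \<alpha> \<phi> h"
        unfolding equivariant_def
      proof (intro ballI)
        fix g s assume g: "g \<in> carrier G" and s: "s \<in> A"
        obtain j where j: "j < n" "\<phi> g (z (d s)) = z j"
          using fixd g dn[OF s] unfolding perm_class_fixed_iff[OF z] by blast
        have "z j \<in> W (\<alpha> g s)"
          using act[OF g s hW[OF s]] s j by (simp add: h_def)
        then have "e j = \<alpha> g s"
          using disj[OF eA[OF j(1)] A1[OF g s] zW[OF j(1)]] by blast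
        then show "h (\<alpha> g s) = \<phi> g (h s)"
          using A1[OF g s] de[OF j(1)] j s by (simp add: h_def)
      qed
      moreover have "inj_on (z \<circ> d) A"
        using z d by (intro comp_inj_on) (auto simp: topspace_ordered_conf bij_betw_def)
      ultimately have h: "h \<in> topspace (gemb G (A, \<alpha>) X \<phi>)"
        using z dn gembD by (auto simp: h_def topspace_ordered_conf inj_on_def PiE_iff)
      have "y h = z"
        using z eA de by (auto simp: y_def h_def topspace_ordered_conf fun_eq_iff PiE_iff extensional_def)
      then show "c \<in> (perm_class n \<circ> y) ` U"
        using WU[OF h] hW c by force
    qed
    ultimately show "\<exists>N. openin (conf_fixed G \<phi> X n) N \<and> (perm_class n \<circ> y) f \<in> N \<and>
        N \<subseteq> (perm_class n \<circ> y) ` U" by blast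
  qed
  have fib: "aut_class G (A, \<alpha>) f = aut_class G (A, \<alpha>) f' \<longleftrightarrow> (perm_class n \<circ> y) f = (perm_class n \<circ> y) f'"
    if "f \<in> topspace (gemb G (A, \<alpha>) X \<phi>)" "f' \<in> topspace (gemb G (A, \<alpha>) X \<phi>)" for f f'
    using aut_class_eq_iff[OF S that] perm_class_eq_iff[OF y_oc[OF that(1)] y_oc[OF that(2)]]
      y_im that by simp
  obtain h where h: "continuous_map (gconf G (A, \<alpha>) X \<phi>) (conf_fixed G \<phi> X n) h"
    "open_map (gconf G (A, \<alpha>) X \<phi>) (conf_fixed G \<phi> X n) h"
    "inj_on h (aut_class G (A, \<alpha>) ` topspace (gemb G (A, \<alpha>) X \<phi>))"
    and hq: "\<And>f. f \<in> topspace (gemb G (A, \<alpha>) X \<phi>) \<Longrightarrow> h (aut_class G (A, \<alpha>) f) = (perm_class n \<circ> y) f"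
    using quotient_topology_induced_map[OF cont opn fib] unfolding gconf_eq by blast
  show ?thesis
  proof (intro exI[of _ h] conjI h(1,2) ballI)
    show "inj_on h (topspace (gconf G (A, \<alpha>) X \<phi>))"
      using h(3) by (simp add: gconf_eq)
    fix z assume z: "z \<in> topspace (ordered_conf X n)"
    have "perm_class n z \<in> h ` topspace (gconf G (A, \<alpha>) X \<phi>) \<longleftrightarrow>
        (\<exists>f \<in> topspace (gemb G (A, \<alpha>) X \<phi>). perm_class n z = perm_class n (y f))"
      using hq by (auto simp: gconf_eq image_iff)
    also have "\<dots> \<longleftrightarrow> (\<exists>f \<in> topspace (gemb G (A, \<alpha>) X \<phi>). f ` A = z ` {..<n})"
      using perm_class_eq_iff[OF z y_oc] y_im by (intro bex_cong refl) auto
    finally show "perm_class n z \<in> h ` topspace (gconf G (A, \<alpha>) X \<phi>) \<longleftrightarrow>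
        (\<exists>f \<in> topspace (gemb G (A, \<alpha>) X \<phi>). f ` A = z ` {..<n})" .
  qed
qed

text \<open>
  The open embeddings have disjoint images, since \<open>G\<close>-sets with a common image are isomorphic, and
  they cover, since an invariant subset is a finite \<open>G\<close>-set and so isomorphic to a chosen one.
\<close>

theorem conf_fixed_decomposition:
  assumes Sc: "\<And>c. c \<in> gset_iso_classes G n \<Longrightarrow> S c \<in> c"
  shows "conf_fixed G \<phi> X n homeomorphic_space
    sum_topology (\<lambda>c. gconf G (S c) X \<phi>) (gset_iso_classes G n)"
proof -
  let ?I = "gset_iso_classes G n :: ('g, nat) gset set set"
  have fin: "S c \<in> finite_gsets G n" if "c \<in> ?I" for c
    using Sc[OF that] in_quotient_imp_subset[OF equiv_gset_iso] that
    unfolding gset_iso_classes_def by blast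
  let ?P = "\<lambda>c h. continuous_map (gconf G (S c) X \<phi>) (conf_fixed G \<phi> X n) h \<and>
      open_map (gconf G (S c) X \<phi>) (conf_fixed G \<phi> X n) h \<and>
      inj_on h (topspace (gconf G (S c) X \<phi>)) \<and>
      (\<forall>y \<in> topspace (ordered_conf X n).
        perm_class n y \<in> h ` topspace (gconf G (S c) X \<phi>) \<longleftrightarrow>
        (\<exists>f \<in> topspace (gemb G (S c) X \<phi>). f ` fst (S c) = y ` {..<n}))"
  have "\<forall>c \<in> ?I. \<exists>h. ?P c h"
  proof
    fix c assume "c \<in> ?I"
    then have "(fst (S c), snd (S c)) \<in> finite_gsets G n"
      using fin by simp
    from gconf_open_embedding[OF this] show "\<exists>h. ?P c h"
      unfolding prod.collapse .
  qed
  then obtain h where h: "\<forall>c \<in> ?I. ?P c (h c)"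
    by (rule bchoice[THEN exE])
  from h have cont: "\<And>c. c \<in> ?I \<Longrightarrow> continuous_map (gconf G (S c) X \<phi>) (conf_fixed G \<phi> X n) (h c)"
    and opn: "\<And>c. c \<in> ?I \<Longrightarrow> open_map (gconf G (S c) X \<phi>) (conf_fixed G \<phi> X n) (h c)"
    and inj: "\<And>c. c \<in> ?I \<Longrightarrow> inj_on (h c) (topspace (gconf G (S c) X \<phi>))"
    and im: "\<And>c y. c \<in> ?I \<Longrightarrow> y \<in> topspace (ordered_conf X n) \<Longrightarrow>
        perm_class n y \<in> h c ` topspace (gconf G (S c) X \<phi>) \<longleftrightarrow>
        (\<exists>f \<in> topspace (gemb G (S c) X \<phi>). f ` fst (S c) = y ` {..<n})"
    by auto
  have fixed_classE: "\<exists>y \<in> topspace (ordered_conf X n). z = perm_class n y"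
    if "z \<in> topspace (conf_fixed G \<phi> X n)" for z
    using that by (auto simp: conf_fixed_def topspace_conf)
  have "sum_topology (\<lambda>c. gconf G (S c) X \<phi>) ?I homeomorphic_space conf_fixed G \<phi> X n"
  proof (rule homeomorphic_space_sum_topologyI[OF cont opn inj])
    fix c d x x'
    assume c: "c \<in> ?I" and d: "d \<in> ?I" and x: "x \<in> topspace (gconf G (S c) X \<phi>)"
      and x': "x' \<in> topspace (gconf G (S d) X \<phi>)" and eq: "h c x = h d x'"
    have "h c x \<in> topspace (conf_fixed G \<phi> X n)"
      using continuous_map_image_subset_topspace[OF cont[OF c]] x by blast
    then obtain y where y: "y \<in> topspace (ordered_conf X n)" and hy: "h c x = perm_class n y"
      using fixed_classE by blast
    obtain f where f: "f \<in> topspace (gemb G (S c) X \<phi>)" "f ` fst (S c) = y ` {..<n}"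
      using im[OF c y] hy x by (metis imageI)
    obtain f' where f': "f' \<in> topspace (gemb G (S d) X \<phi>)" "f' ` fst (S d) = y ` {..<n}"
      using im[OF d y] hy eq x' by (metis imageI)
    have "gset_iso G (S c) (S d)"
      using gemb_equal_images[OF fin[OF c] fin[OF d] f(1) f'(1)] f(2) f'(2)
      unfolding gset_iso_def by metis
    then show "c = d"
      using quotient_eqI[OF equiv_gset_iso _ _ Sc[OF c] Sc[OF d]] c d fin
      unfolding gset_iso_classes_def by blast
  next
    show "topspace (conf_fixed G \<phi> X n) \<subseteq> (\<Union>c\<in>?I. h c ` topspace (gconf G (S c) X \<phi>))"
    proof
      fix z assume z: "z \<in> topspace (conf_fixed G \<phi> X n)"
      then obtain y where y: "y \<in> topspace (ordered_conf X n)" and zy: "z = perm_class n y"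
        using fixed_classE by blast
      define F where "F = y ` {..<n}"
      have F: "F \<subseteq> topspace X" "finite F" "card F = n"
        using y by (auto simp: F_def topspace_ordered_conf card_image)
      have "\<phi> g x \<in> F" if "g \<in> carrier G" "x \<in> F" for g x
        using z that unfolding zy perm_class_fixed_iff[OF y] F_def by blast
      then have FG: "(F, \<lambda>g. restrict (\<phi> g) F) \<in> finite_gsets G n"
        using invariant_subset_gset[of F] F by simp
      obtain T :: "('g, nat) gset" where T: "T \<in> finite_gsets G n"
        and FT: "gset_iso G (F, \<lambda>g. restrict (\<phi> g) F) T"
        using gset_iso_nat[OF FG] by blast
      define c :: "('g, nat) gset set" where "c = {(S, T). S \<in> finite_gsets G n \<and> T \<in> finite_gsets G n \<and> gset_iso G S T} `` {T}"
      have c: "c \<in> ?I"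
        unfolding c_def gset_iso_classes_def using T by (rule quotientI)
      have "gset_iso G T (S c)"
        using Sc[OF c] by (auto simp: c_def)
      then have "gset_iso G (S c) (F, \<lambda>g. restrict (\<phi> g) F)"
        using gset_iso_sym[OF FG] gset_iso_trans[OF FT] by blast
      then obtain f where f: "bij_betw f (fst (S c)) F"
        "equivariant G (fst (S c)) (snd (S c)) (\<lambda>g. restrict (\<phi> g) F) f"
        by (auto simp: gset_iso_def)
      have fF: "f s \<in> F" if "s \<in> fst (S c)" for s
        using f(1) that by (auto simp: bij_betw_def)
      have inS: "snd (S c) g s \<in> fst (S c)" if "g \<in> carrier G" "s \<in> fst (S c)" for g s
        using fin[OF c] that group_action.element_image[of G "fst (S c)" "snd (S c)"]
        by (auto simp: finite_gsets_def)
      have "restrict f (fst (S c)) \<in> topspace (gemb G (S c) X \<phi>)"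
        unfolding topspace_gemb[OF fin[OF c]]
        using f fF F(1) inS by (auto simp: equivariant_def bij_betw_def inj_on_def)
      moreover have "restrict f (fst (S c)) ` fst (S c) = y ` {..<n}"
        using f(1) by (simp add: bij_betw_def F_def)
      ultimately show "z \<in> (\<Union>c\<in>?I. h c ` topspace (gconf G (S c) X \<phi>))"
        unfolding zy using im[OF c y] c by blast
    qed
  qed
  then show ?thesis by (rule homeomorphic_space_sym[THEN iffD1])
qed

end


section \<open>Conjugate stabilizers\<close>

lemma (in group) lcos_eq_iff:
  assumes H: "subgroup H G" and g: "g \<in> carrier G" and h: "h \<in> carrier G"
  shows "g <# H = h <# H \<longleftrightarrow> inv h \<otimes> g \<in> H"
proof
  assume "g <# H = h <# H"
  then have "g \<in> h <# H" using lcos_self[OF g H] by simp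
  then obtain x where x: "x \<in> H" "g = h \<otimes> x" by (auto simp: l_coset_def)
  then have "inv h \<otimes> g = x"
    using h subgroup.mem_carrier[OF H] by (simp add: m_assoc[symmetric])
  with x show "inv h \<otimes> g \<in> H" by simp
next
  assume *: "inv h \<otimes> g \<in> H"
  have "g = h \<otimes> (inv h \<otimes> g)" using g h by (simp add: m_assoc[symmetric])
  with * have "g \<in> h <# H" unfolding l_coset_def by blast
  then show "g <# H = h <# H" using l_repr_independence[OF _ h H] by simp
qed

lemma (in group) conj_action: "group_action G {H. subgroup H G} (conj_act G)"
  unfolding conj_act_def by (rule action_by_conjugation_on_subgroups_set)

lemma (in group) conj_act_eq_image:
  assumes "subgroup H G" "g \<in> carrier G"
  shows "conj_act G g H = (\<lambda>h. g \<otimes> h \<otimes> inv g) ` H"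
  using assms by (auto simp: conj_act_def l_coset_def r_coset_def)

lemma (in group) conj_class_eq_iff:
  assumes "subgroup H G" "subgroup K G"
  shows "conj_class G H = conj_class G K \<longleftrightarrow> (\<exists>g \<in> carrier G. K = conj_act G g H)"
  using group_action.orbit_eq_iff[OF conj_action, of H K] assms
  by (auto simp: conj_class_def orbit_def)

lemma (in group) mem_conj_class:
  assumes "c \<in> conj_classes G" "H \<in> c"
  shows "subgroup H G" and "conj_class G H = c"
proof -
  interpret C: group_action G "{H. subgroup H G}" "conj_act G" by (rule conj_action)
  obtain K where K: "subgroup K G" "c = orbit G (conj_act G) K"
    using assms(1) by (auto simp: conj_classes_def orbits_def)
  then show H: "subgroup H G"
    using assms(2) C.element_image by (auto simp: orbit_def)
  show "conj_class G H = c"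
    using C.orbit_eq_iff[of K H] K H assms(2) by (simp add: conj_class_def)
qed

lemma (in group) finite_conj_classes:
  assumes "finite (carrier G)"
  shows "finite (conj_classes G)"
proof (rule finite_subset)
  show "conj_classes G \<subseteq> Pow (Pow (carrier G))"
    using mem_conj_class(1) subgroup.subset by fastforce
  show "finite (Pow (Pow (carrier G)))" using assms by simp
qed

text \<open>
  A finite subgroup is not conjugate to a proper subgroup of itself, because conjugates have the same
  cardinality.
\<close>

lemma (in group) conjugate_subset_eq:
  assumes H: "subgroup H G" and K: "subgroup K G" and fin: "finite (carrier G)"
    and conj: "conj_class G H = conj_class G K" and sub: "K \<subseteq> H"
  shows "K = H"
proof (rule card_subset_eq[OF _ sub])
  show "finite H" using fin subgroup.subset[OF H] by (rule rev_finite_subset)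
  obtain g where g: "g \<in> carrier G" and Kg: "K = conj_act G g H"
    using conj unfolding conj_class_eq_iff[OF H K] by blast
  have "inj_on (\<lambda>h. g \<otimes> h \<otimes> inv g) H"
    using g subgroup.mem_carrier[OF H] by (auto simp: inj_on_def)
  then show "card K = card H"
    unfolding Kg conj_act_eq_image[OF H g] by (rule card_image)
qed

context group_action
begin

lemma stabilizer_act:
  assumes g: "g \<in> carrier G" and x: "x \<in> E"
  shows "stabilizer G \<phi> (\<phi> g x) = conj_act G g (stabilizer G \<phi> x)"
proof -
  have "k \<in> (\<lambda>h. g \<otimes> h \<otimes> inv g) ` stabilizer G \<phi> x" if k: "k \<in> stabilizer G \<phi> (\<phi> g x)" for k
  proof
    have kG: "k \<in> carrier G" and fix_k: "\<phi> k (\<phi> g x) = \<phi> g x"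
      using k by (auto simp: stabilizer_def)
    show "k = g \<otimes> (inv g \<otimes> k \<otimes> g) \<otimes> inv g"
      using g kG by (simp add: m_assoc) (simp add: m_assoc[symmetric])
    show "inv g \<otimes> k \<otimes> g \<in> stabilizer G \<phi> x"
      using g kG x fix_k act_inv[OF g x] by (simp add: stabilizer_def composition_rule act_closed)
  qed
  moreover have "g \<otimes> h \<otimes> inv g \<in> stabilizer G \<phi> (\<phi> g x)" if "h \<in> stabilizer G \<phi> x" for h
    using that g x act_inv[OF g x] by (simp add: stabilizer_def composition_rule act_closed)
  ultimately show ?thesis
    unfolding conj_act_eq_image[OF stabilizer_subgroup[OF x] g] by blast
qed

lemma conj_class_stabilizer_act:
  assumes "g \<in> carrier G" "x \<in> E"
  shows "conj_class G (stabilizer G \<phi> (\<phi> g x)) = conj_class G (stabilizer G \<phi> x)"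
  using conj_class_eq_iff[OF stabilizer_subgroup stabilizer_subgroup, of x "\<phi> g x"]
    stabilizer_act[OF assms] act_closed assms by auto

end

context Hausdorff_G_space
begin

definition pts_of_type :: "'g set set \<Rightarrow> 'x set" where
  "pts_of_type c = {x \<in> topspace X. conj_class G (stabilizer G \<phi> x) = c}"

lemma stratum_eq: "stratum G \<phi> X c = subtopology X (pts_of_type c)"
  by (simp add: stratum_def pts_of_type_def)

lemma topspace_stratum_orbit_space:
  "topspace (orbit_space G \<phi> (stratum G \<phi> X c)) = orbit G \<phi> ` pts_of_type c"
  by (auto simp: orbit_space_def stratum_eq pts_of_type_def)

text \<open>
  The orbit map of a stratum is open: the saturation of an open set is the union of its translates.
\<close>

lemma openin_orbit_image:
  assumes U: "openin X U"
  shows "openin (orbit_space G \<phi> (stratum G \<phi> X c)) (orbit G \<phi> ` (U \<inter> pts_of_type c))"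
proof -
  let ?M = "pts_of_type c"
  have M: "?M \<subseteq> topspace X" by (auto simp: pts_of_type_def)
  have MG: "\<phi> g x \<in> ?M" if "g \<in> carrier G" "x \<in> ?M" for g x
    using that conj_class_stabilizer_act act_closed by (auto simp: pts_of_type_def)
  have "{x \<in> topspace (stratum G \<phi> X c). orbit G \<phi> x \<in> orbit G \<phi> ` (U \<inter> ?M)}
      = (\<Union>g \<in> carrier G. {x \<in> topspace X. \<phi> g x \<in> U}) \<inter> ?M" (is "?L = ?R")
  proof
    show "?L \<subseteq> ?R"
    proof
      fix x assume "x \<in> ?L"
      then obtain u where x: "x \<in> ?M" and u: "u \<in> U" "u \<in> ?M" and eq: "orbit G \<phi> x = orbit G \<phi> u"
        by (auto simp: stratum_eq)
      then have "u \<in> orbit G \<phi> x" using M orbit_refl by auto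
      then show "x \<in> ?R" using u x M by (auto simp: orbit_def)
    qed
    show "?R \<subseteq> ?L"
    proof
      fix x assume "x \<in> ?R"
      then obtain g where x: "x \<in> ?M" and g: "g \<in> carrier G" "\<phi> g x \<in> U" by blast
      then have "orbit G \<phi> x = orbit G \<phi> (\<phi> g x)" using orbit_act M by blast
      then show "x \<in> ?L" using g x MG M by (auto simp: stratum_eq)
    qed
  qed
  moreover have "openin X (\<Union>g \<in> carrier G. {x \<in> topspace X. \<phi> g x \<in> U})"
    using openin_continuous_map_preimage[OF continuous_act U] by (auto intro!: openin_Union)
  ultimately have "openin (stratum G \<phi> X c)
      {x \<in> topspace (stratum G \<phi> X c). orbit G \<phi> x \<in> orbit G \<phi> ` (U \<inter> ?M)}"
    by (simp only: stratum_eq openin_subtopology_Int)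
  then show ?thesis
    unfolding orbit_space_def openin_quotient_topology using M by (auto simp: stratum_eq)
qed

end


section \<open>Configurations of a given orbit type\<close>

locale orbit_type_gset = Hausdorff_G_space G X \<phi>
  for G :: "('g, 'm) monoid_scheme" (structure) and X :: "'x topology" and \<phi> +
  fixes R :: "'g set set \<Rightarrow> 'g set" and k :: "'g set set \<Rightarrow> nat"
  assumes R: "\<And>c. c \<in> conj_classes G \<Longrightarrow> R c \<in> c"
begin

text \<open>
  The orbit in the \<open>i\<close>-th copy of \<open>G / R c\<close> is handled through its base point \<open>(c, i, R c)\<close>, whose
  stabilizer is \<open>R c\<close> itself and not just a conjugate of it. An equivariant map out of the orbit sum is
  determined by its values on base points.
\<close>

definition osum :: "('g set set \<times> nat \<times> 'g set) set" where
  "osum = fst (orbit_sum G R k)"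

definition osum_act :: "'g \<Rightarrow> ('g set set \<times> nat \<times> 'g set) \<Rightarrow> ('g set set \<times> nat \<times> 'g set)" where
  "osum_act = snd (orbit_sum G R k)"

lemma orbit_sum_eq: "orbit_sum G R k = (osum, osum_act)"
  by (simp add: osum_def osum_act_def)

lemma osum_gset: "(osum, osum_act) \<in> finite_gsets G (card osum)"
  using orbit_sum_in_finite_gsets[OF group_axioms finite_G R, of k] by (simp add: osum_def osum_act_def)

lemma R_subgroup: "c \<in> conj_classes G \<Longrightarrow> subgroup (R c) G"
  and R_class: "c \<in> conj_classes G \<Longrightarrow> conj_class G (R c) = c"
  using mem_conj_class R by blast+

lemma osum_iff: "(c, i, C) \<in> osum \<longleftrightarrow> c \<in> conj_classes G \<and> i < k c \<and> C \<in> lcosets (R c)"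
  by (simp add: osum_def orbit_sum_def Let_def)

lemma base_in_osum:
  assumes "c \<in> conj_classes G" "i < k c"
  shows "(c, i, R c) \<in> osum"
proof -
  have "R c = \<one> <# R c"
    using subgroup.subset[OF R_subgroup[OF assms(1)]] by (simp add: lcos_mult_one)
  then show ?thesis
    using assms by (auto simp: osum_iff LCOSETS_def)
qed

lemma osum_act_base:
  assumes "c \<in> conj_classes G" "i < k c"
  shows "osum_act g (c, i, R c) = (c, i, g <# R c)"
proof -
  have "osum_act = (\<lambda>g. \<lambda>(c, i, C) \<in> osum. (c, i, g <# C))"
    by (simp add: osum_act_def osum_def orbit_sum_def Let_def)
  then show ?thesis
    using base_in_osum[OF assms] by simp
qed

lemma osum_act_closed: "g \<in> carrier G \<Longrightarrow> s \<in> osum \<Longrightarrow> osum_act g s \<in> osum"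
  using osum_gset group_action.element_image[of G osum osum_act] by (auto simp: finite_gsets_def)

lemma osum_cases:
  assumes "s \<in> osum"
  obtains c i g where "c \<in> conj_classes G" "i < k c" "g \<in> carrier G" "s = osum_act g (c, i, R c)"
proof -
  obtain c i C where s: "s = (c, i, C)" by (cases s) auto
  with assms have ci: "c \<in> conj_classes G" "i < k c" and "C \<in> lcosets (R c)"
    by (auto simp: osum_iff)
  then obtain g where g: "g \<in> carrier G" and C: "C = g <# R c" by (auto simp: LCOSETS_def)
  show thesis
    by (rule that[OF ci g]) (simp add: osum_act_base[OF ci] s C)
qed

lemma osum_act_base_eq_iff:
  assumes ci: "c \<in> conj_classes G" "i < k c" and gh: "g \<in> carrier G" "h \<in> carrier G"
  shows "osum_act g (c, i, R c) = osum_act h (c, i, R c) \<longleftrightarrow> inv h \<otimes> g \<in> R c"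
  using lcos_eq_iff[OF R_subgroup[OF ci(1)] gh] by (simp add: osum_act_base[OF ci])

lemma osum_act_base_fixed_iff:
  assumes ci: "c \<in> conj_classes G" "i < k c" and g: "g \<in> carrier G"
  shows "osum_act g (c, i, R c) = (c, i, R c) \<longleftrightarrow> g \<in> R c"
proof -
  have "osum_act \<one> (c, i, R c) = (c, i, R c)"
    using subgroup.subset[OF R_subgroup[OF ci(1)]] by (simp add: osum_act_base[OF ci] lcos_mult_one)
  then show ?thesis
    using osum_act_base_eq_iff[OF ci g one_closed] g by simp
qed

lemma topspace_gemb_osum:
  "topspace (gemb G (osum, osum_act) X \<phi>) =
    {f \<in> osum \<rightarrow>\<^sub>E topspace X. inj_on f osum \<and> equivariant G osum osum_act \<phi> f}"
  using topspace_gemb[OF osum_gset] by simp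

text \<open>
  The stabilizer condition makes \<open>g (R c) \<mapsto> g x\<close> well defined and injective on each orbit. Distinctness
  of orbits is asked only within one \<open>c\<close>: points with stabilizers in different conjugacy classes never
  share an orbit.
\<close>

lemma embedding_from_orbit_representatives:
  assumes x: "\<And>c i. c \<in> conj_classes G \<Longrightarrow> i < k c \<Longrightarrow> x c i \<in> topspace X"
    and stab: "\<And>c i. c \<in> conj_classes G \<Longrightarrow> i < k c \<Longrightarrow> stabilizer G \<phi> (x c i) = R c"
    and inj: "\<And>c i j. c \<in> conj_classes G \<Longrightarrow> i < k c \<Longrightarrow> j < k c \<Longrightarrow>
      orbit G \<phi> (x c i) = orbit G \<phi> (x c j) \<Longrightarrow> i = j"
  obtains f where "f \<in> topspace (gemb G (osum, osum_act) X \<phi>)"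
    and "\<And>c i g. c \<in> conj_classes G \<Longrightarrow> i < k c \<Longrightarrow> g \<in> carrier G \<Longrightarrow>
      f (osum_act g (c, i, R c)) = \<phi> g (x c i)"
proof -
  interpret A: group_action G osum osum_act using osum_gset by (simp add: finite_gsets_def)
  define f where "f = (\<lambda>(c, i, C) \<in> osum. \<phi> (SOME g. g \<in> C) (x c i))"
  have f: "f (osum_act g (c, i, R c)) = \<phi> g (x c i)"
    if ci: "c \<in> conj_classes G" "i < k c" and g: "g \<in> carrier G" for c i g
  proof -
    note H = R_subgroup[OF ci(1)]
    have "(SOME g'. g' \<in> g <# R c) \<in> g <# R c"
      using lcos_self[OF g H] by (rule someI)
    then obtain h where h: "h \<in> R c" and eq: "(SOME g'. g' \<in> g <# R c) = g \<otimes> h"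
      by (auto simp: l_coset_def)
    have "h \<in> carrier G" "\<phi> h (x c i) = x c i"
      using h stab[OF ci] by (auto simp: stabilizer_def)
    moreover have "(c, i, g <# R c) \<in> osum"
      using osum_act_closed[OF g base_in_osum[OF ci]] osum_act_base[OF ci] by simp
    ultimately show ?thesis
      using eq g x[OF ci] by (simp add: f_def osum_act_base[OF ci] composition_rule)
  qed
  have "f \<in> osum \<rightarrow>\<^sub>E topspace X"
  proof
    show "f s \<in> topspace X" if "s \<in> osum" for s
      using osum_cases[OF that] f x act_closed by metis
  qed (simp add: f_def)
  moreover have "inj_on f osum"
  proof (rule inj_onI)
    fix s t assume s: "s \<in> osum" and t: "t \<in> osum" and eq: "f s = f t"
    obtain c i g where ci: "c \<in> conj_classes G" "i < k c" and g: "g \<in> carrier G"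
      and sg: "s = osum_act g (c, i, R c)" using osum_cases[OF s] .
    obtain d j h where dj: "d \<in> conj_classes G" "j < k d" and h: "h \<in> carrier G"
      and th: "t = osum_act h (d, j, R d)" using osum_cases[OF t] .
    have eq': "\<phi> g (x c i) = \<phi> h (x d j)"
      using eq f ci g dj h sg th by simp
    \<comment> \<open>The common value determines the conjugacy class, then the copy, then the coset.\<close>
    have "conj_class G (R c) = conj_class G (R d)"
      using conj_class_stabilizer_act[OF g x[OF ci]] conj_class_stabilizer_act[OF h x[OF dj]]
      by (simp add: stab ci dj eq')
    then have cd: "c = d" using R_class ci dj by simp
    have "orbit G \<phi> (x c i) = orbit G \<phi> (x d j)"
      using orbit_act[OF g x[OF ci]] orbit_act[OF h x[OF dj]] eq' by simp
    then have ij: "i = j" using inj ci dj cd by blast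
    have "\<phi> (inv h \<otimes> g) (x c i) = x c i"
      using eq' act_inv[OF h x[OF dj]] g h x[OF ci] cd ij by (simp add: composition_rule)
    then have "inv h \<otimes> g \<in> R c"
      using g h by (simp add: stab[OF ci, symmetric] stabilizer_def)
    then show "s = t"
      using osum_act_base_eq_iff[OF ci g h] sg th cd ij by simp
  qed
  moreover have "equivariant G osum osum_act \<phi> f"
    unfolding equivariant_def
  proof (intro ballI)
    fix g s assume g: "g \<in> carrier G" and s: "s \<in> osum"
    obtain c i h where ci: "c \<in> conj_classes G" "i < k c" and h: "h \<in> carrier G"
      and sh: "s = osum_act h (c, i, R c)" using osum_cases[OF s] .
    have "osum_act g s = osum_act (g \<otimes> h) (c, i, R c)"
      using A.composition_rule[OF base_in_osum[OF ci] g h] sh by simp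
    then show "f (osum_act g s) = \<phi> g (f s)"
      using f[OF ci] g h sh composition_rule[OF x[OF ci] g h] by simp
  qed
  ultimately have emb: "f \<in> topspace (gemb G (osum, osum_act) X \<phi>)"
    by (simp add: topspace_gemb_osum)
  show thesis by (rule that[OF emb f])
qed

definition orbits_of_type :: "(('g set set \<times> nat \<times> 'g set) \<Rightarrow> 'x) \<Rightarrow> 'g set set \<Rightarrow> nat \<Rightarrow> 'x set"
  where "orbits_of_type f c = (\<lambda>i \<in> {..<k c}. orbit G \<phi> (f (c, i, R c)))"

context
  fixes f assumes f: "f \<in> topspace (gemb G (osum, osum_act) X \<phi>)"
begin

lemma emb_closed: "s \<in> osum \<Longrightarrow> f s \<in> topspace X"
  and emb_inj: "inj_on f osum"
  and emb_act: "g \<in> carrier G \<Longrightarrow> s \<in> osum \<Longrightarrow> f (osum_act g s) = \<phi> g (f s)"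
  using f by (auto simp: topspace_gemb_osum equivariant_def)

lemma stabilizer_emb_base:
  assumes ci: "c \<in> conj_classes G" "i < k c"
  shows "stabilizer G \<phi> (f (c, i, R c)) = R c"
proof -
  note b = base_in_osum[OF ci]
  have "\<phi> g (f (c, i, R c)) = f (c, i, R c) \<longleftrightarrow> g \<in> R c" if g: "g \<in> carrier G" for g
    using emb_act[OF g b] inj_on_eq_iff[OF emb_inj osum_act_closed[OF g b] b]
      osum_act_base_fixed_iff[OF ci g] by simp
  then show ?thesis
    using subgroup.subset[OF R_subgroup[OF ci(1)]] by (auto simp: stabilizer_def)
qed

lemma emb_base_type:
  assumes ci: "c \<in> conj_classes G" "i < k c"
  shows "f (c, i, R c) \<in> pts_of_type c"
  using emb_closed[OF base_in_osum[OF ci]] stabilizer_emb_base[OF ci] R_class ci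
  by (simp add: pts_of_type_def)

lemma orbits_of_type_ordered_conf:
  assumes c: "c \<in> conj_classes G"
  shows "orbits_of_type f c \<in> topspace (ordered_conf (orbit_space G \<phi> (stratum G \<phi> X c)) (k c))"
proof -
  have "i = j"
    if i: "i < k c" and j: "j < k c" and eq: "orbit G \<phi> (f (c, i, R c)) = orbit G \<phi> (f (c, j, R c))"
    for i j
  proof -
    have "f (c, j, R c) \<in> orbit G \<phi> (f (c, i, R c))"
      using eq orbit_refl[OF emb_closed[OF base_in_osum[OF c j]]] by simp
    then obtain g where g: "g \<in> carrier G" "f (c, j, R c) = \<phi> g (f (c, i, R c))"
      by (auto simp: orbit_def)
    then have "f (c, j, R c) = f (osum_act g (c, i, R c))"
      using emb_act base_in_osum[OF c i] by simp
    then have "(c, j, R c) = osum_act g (c, i, R c)"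
      using inj_onD[OF emb_inj] base_in_osum[OF c] i j osum_act_closed[OF g(1)] by blast
    then show "i = j" using osum_act_base[OF c i] by simp
  qed
  then show ?thesis
    using emb_base_type[OF c]
    by (auto simp: topspace_ordered_conf topspace_stratum_orbit_space orbits_of_type_def inj_on_def)
qed

text \<open>
  This lemma and the next recover the orbits of each type from the image of \<open>f\<close> and the image from the
  orbits, so that orbit data and image carry the same information.
\<close>

lemma orbits_of_type_image:
  assumes c: "c \<in> conj_classes G"
  shows "orbits_of_type f c ` {..<k c} = orbit G \<phi> ` (f ` osum \<inter> pts_of_type c)"
proof
  show "orbits_of_type f c ` {..<k c} \<subseteq> orbit G \<phi> ` (f ` osum \<inter> pts_of_type c)"
    using base_in_osum[OF c] emb_base_type[OF c] by (auto simp: orbits_of_type_def)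
  show "orbit G \<phi> ` (f ` osum \<inter> pts_of_type c) \<subseteq> orbits_of_type f c ` {..<k c}"
  proof clarify
    fix s assume s: "s \<in> osum" and type: "f s \<in> pts_of_type c"
    obtain d i g where di: "d \<in> conj_classes G" "i < k d" and g: "g \<in> carrier G"
      and sg: "s = osum_act g (d, i, R d)" using osum_cases[OF s] .
    note b = base_in_osum[OF di]
    have fs: "f s = \<phi> g (f (d, i, R d))" using emb_act[OF g b] sg by simp
    have "d = c"
      using type emb_base_type[OF di] conj_class_stabilizer_act[OF g emb_closed[OF b]]
      by (simp add: fs pts_of_type_def)
    then show "orbit G \<phi> (f s) \<in> orbits_of_type f c ` {..<k c}"
      using di orbit_act[OF g emb_closed[OF b]] by (auto simp: fs orbits_of_type_def)
  qed
qed

lemma emb_image_eq_orbits: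
  "f ` osum = (\<Union>c \<in> conj_classes G. \<Union>(orbits_of_type f c ` {..<k c}))"
proof
  show "f ` osum \<subseteq> (\<Union>c \<in> conj_classes G. \<Union>(orbits_of_type f c ` {..<k c}))"
  proof clarify
    fix s assume s: "s \<in> osum"
    obtain c i g where ci: "c \<in> conj_classes G" "i < k c" and g: "g \<in> carrier G"
      and sg: "s = osum_act g (c, i, R c)" using osum_cases[OF s] .
    have "f s \<in> orbits_of_type f c i"
      using emb_act[OF g base_in_osum[OF ci]] sg g ci by (auto simp: orbits_of_type_def orbit_def)
    then show "f s \<in> (\<Union>c \<in> conj_classes G. \<Union>(orbits_of_type f c ` {..<k c}))"
      using ci by blast
  qed
  show "(\<Union>c \<in> conj_classes G. \<Union>(orbits_of_type f c ` {..<k c})) \<subseteq> f ` osum"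
  proof
    fix x assume "x \<in> (\<Union>c \<in> conj_classes G. \<Union>(orbits_of_type f c ` {..<k c}))"
    then obtain c i where ci: "c \<in> conj_classes G" and i: "i < k c" and x: "x \<in> orbits_of_type f c i"
      by blast
    obtain g where g: "g \<in> carrier G" "x = \<phi> g (f (c, i, R c))"
      using x i by (auto simp: orbits_of_type_def orbit_def)
    then have "x = f (osum_act g (c, i, R c))" using emb_act base_in_osum[OF ci i] by simp
    then show "x \<in> f ` osum" using osum_act_closed[OF g(1) base_in_osum[OF ci i]] by blast
  qed
qed

end

definition orbit_conf ::
  "(('g set set \<times> nat \<times> 'g set) \<Rightarrow> 'x) \<Rightarrow> 'g set set \<Rightarrow> (nat \<Rightarrow> 'x set) set" where
  "orbit_conf f = (\<lambda>c \<in> conj_classes G. perm_class (k c) (orbits_of_type f c))"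

abbreviation typed_confs :: "('g set set \<Rightarrow> (nat \<Rightarrow> 'x set) set) topology" where
  "typed_confs \<equiv> product_topology (\<lambda>c. conf (orbit_space G \<phi> (stratum G \<phi> X c)) (k c)) (conj_classes G)"

lemma orbit_conf_eq_iff:
  assumes f: "f \<in> topspace (gemb G (osum, osum_act) X \<phi>)" and h: "h \<in> topspace (gemb G (osum, osum_act) X \<phi>)"
  shows "orbit_conf f = orbit_conf h \<longleftrightarrow> f ` osum = h ` osum"
proof -
  have "orbit_conf f = orbit_conf h \<longleftrightarrow> (\<forall>c \<in> conj_classes G. orbit_conf f c = orbit_conf h c)"
    by (auto simp: orbit_conf_def fun_eq_iff)
  also have "\<dots> \<longleftrightarrow>
      (\<forall>c \<in> conj_classes G. orbits_of_type f c ` {..<k c} = orbits_of_type h c ` {..<k c})"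
    using perm_class_eq_iff[OF orbits_of_type_ordered_conf[OF f] orbits_of_type_ordered_conf[OF h]]
    by (simp add: orbit_conf_def)
  also have "\<dots> \<longleftrightarrow> f ` osum = h ` osum"
  proof
    assume "\<forall>c \<in> conj_classes G. orbits_of_type f c ` {..<k c} = orbits_of_type h c ` {..<k c}"
    then show "f ` osum = h ` osum"
      unfolding emb_image_eq_orbits[OF f] emb_image_eq_orbits[OF h] by simp
  next
    assume "f ` osum = h ` osum"
    then show "\<forall>c \<in> conj_classes G. orbits_of_type f c ` {..<k c} = orbits_of_type h c ` {..<k c}"
      by (simp add: orbits_of_type_image[OF f] orbits_of_type_image[OF h])
  qed
  finally show ?thesis .
qed

lemma continuous_map_orbit_conf: "continuous_map (gemb G (osum, osum_act) X \<phi>) typed_confs orbit_conf"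
  unfolding continuous_map_componentwise
proof (intro conjI ballI)
  show "orbit_conf ` topspace (gemb G (osum, osum_act) X \<phi>) \<subseteq> extensional (conj_classes G)"
    by (auto simp: orbit_conf_def)
  fix c assume c: "c \<in> conj_classes G"
  let ?Z = "orbit_space G \<phi> (stratum G \<phi> X c)"
  have "continuous_map (gemb G (osum, osum_act) X \<phi>) ?Z (\<lambda>f. orbit G \<phi> (f (c, i, R c)))"
    if i: "i < k c" for i
  proof -
    have "continuous_map (gemb G (osum, osum_act) X \<phi>) X (\<lambda>f. f (c, i, R c))"
      unfolding gemb_def fst_conv
      using base_in_osum[OF c i]
      by (intro continuous_map_from_subtopology continuous_map_product_projection)
    then have "continuous_map (gemb G (osum, osum_act) X \<phi>) (stratum G \<phi> X c) (\<lambda>f. f (c, i, R c))"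
      unfolding stratum_eq continuous_map_in_subtopology using emb_base_type[OF _ c i] by auto
    from continuous_map_compose[OF this quotient_imp_continuous_map[OF quotient_map_quotient_topology]]
    show ?thesis by (simp add: orbit_space_def comp_def)
  qed
  then have "continuous_map (gemb G (osum, osum_act) X \<phi>) (product_topology (\<lambda>_. ?Z) {..<k c})
      (\<lambda>f. orbits_of_type f c)"
    unfolding continuous_map_componentwise by (auto simp: orbits_of_type_def)
  then have "continuous_map (gemb G (osum, osum_act) X \<phi>) (ordered_conf ?Z (k c)) (\<lambda>f. orbits_of_type f c)"
    using orbits_of_type_ordered_conf[OF _ c]
    unfolding ordered_conf_def continuous_map_in_subtopology by (auto simp: ordered_conf_def)
  from continuous_map_compose[OF this continuous_map_perm_class]
  show "continuous_map (gemb G (osum, osum_act) X \<phi>) (conf ?Z (k c)) (\<lambda>f. orbit_conf f c)"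
    using c by (simp add: orbit_conf_def comp_def)
qed

text \<open>
  Common core of surjectivity and openness. The values of \<open>f\<close> are recorded as well, since openness
  has to know that \<open>f\<close> is close to a given embedding.
\<close>

lemma orbit_conf_realize:
  assumes y: "\<And>c. c \<in> conj_classes G \<Longrightarrow>
      y c \<in> topspace (ordered_conf (orbit_space G \<phi> (stratum G \<phi> X c)) (k c))"
    and x: "\<And>c i. c \<in> conj_classes G \<Longrightarrow> i < k c \<Longrightarrow>
      x c i \<in> topspace X \<and> stabilizer G \<phi> (x c i) = R c \<and> orbit G \<phi> (x c i) = y c i"
  obtains f where "f \<in> topspace (gemb G (osum, osum_act) X \<phi>)"
    and "orbit_conf f = (\<lambda>c \<in> conj_classes G. perm_class (k c) (y c))"
    and "\<forall>c \<in> conj_classes G. \<forall>i<k c. \<forall>g \<in> carrier G. f (osum_act g (c, i, R c)) = \<phi> g (x c i)"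
proof -
  have inj: "i = j" if c: "c \<in> conj_classes G" and ij: "i < k c" "j < k c"
    and eq: "orbit G \<phi> (x c i) = orbit G \<phi> (x c j)" for c i j
    using y[OF c] x[OF c ij(1)] x[OF c ij(2)] ij eq
    by (auto simp: topspace_ordered_conf dest!: inj_onD[of "y c" _ i j])
  obtain f where f: "f \<in> topspace (gemb G (osum, osum_act) X \<phi>)"
    and fx: "\<And>c i g. c \<in> conj_classes G \<Longrightarrow> i < k c \<Longrightarrow> g \<in> carrier G \<Longrightarrow>
      f (osum_act g (c, i, R c)) = \<phi> g (x c i)"
    by (rule embedding_from_orbit_representatives[of x]) (use x inj in auto)
  have "orbits_of_type f c = y c" if c: "c \<in> conj_classes G" for c
  proof
    fix i show "orbits_of_type f c i = y c i"
    proof (cases "i < k c")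
      case True
      have "osum_act \<one> (c, i, R c) = (c, i, R c)"
        using osum_act_base_fixed_iff[OF c True one_closed] subgroup.one_closed[OF R_subgroup[OF c]] by simp
      then have "f (c, i, R c) = x c i"
        using fx[OF c True one_closed] x[OF c True] by (simp add: act_one)
      then show ?thesis using True x[OF c True] by (simp add: orbits_of_type_def)
    next
      case False
      then show ?thesis
        using y[OF c] by (auto simp: orbits_of_type_def topspace_ordered_conf PiE_iff extensional_def)
    qed
  qed
  then have conf: "orbit_conf f = (\<lambda>c \<in> conj_classes G. perm_class (k c) (y c))"
    unfolding orbit_conf_def by (intro restrict_ext) simp
  show thesis by (rule that[OF f conf]) (use fx in blast)
qed

text \<open>
  An orbit of type \<open>c\<close> contains a point with stabilizer exactly \<open>R c\<close>: translate any of its points by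
  an element that conjugates the stabilizer to \<open>R c\<close>.
\<close>

lemma orbit_conf_surj: "orbit_conf ` topspace (gemb G (osum, osum_act) X \<phi>) = topspace typed_confs"
proof
  show "orbit_conf ` topspace (gemb G (osum, osum_act) X \<phi>) \<subseteq> topspace typed_confs"
    by (rule continuous_map_image_subset_topspace[OF continuous_map_orbit_conf])
  show "topspace typed_confs \<subseteq> orbit_conf ` topspace (gemb G (osum, osum_act) X \<phi>)"
  proof
    fix z assume z: "z \<in> topspace typed_confs"
    have "\<forall>c \<in> conj_classes G.
        \<exists>y \<in> topspace (ordered_conf (orbit_space G \<phi> (stratum G \<phi> X c)) (k c)). z c = perm_class (k c) y"
      using z by (auto simp: topspace_conf PiE_iff)
    then obtain y where y: "\<And>c. c \<in> conj_classes G \<Longrightarrow>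
        y c \<in> topspace (ordered_conf (orbit_space G \<phi> (stratum G \<phi> X c)) (k c))"
      and zy: "\<And>c. c \<in> conj_classes G \<Longrightarrow> z c = perm_class (k c) (y c)"
      by metis
    have "\<exists>x. x \<in> topspace X \<and> stabilizer G \<phi> x = R c \<and> orbit G \<phi> x = y c i"
      if c: "c \<in> conj_classes G" and i: "i < k c" for c i
    proof -
      have "y c i \<in> orbit G \<phi> ` pts_of_type c"
        using y[OF c] i by (auto simp: topspace_ordered_conf topspace_stratum_orbit_space)
      then obtain x where x: "x \<in> topspace X" "conj_class G (stabilizer G \<phi> x) = c"
        and yx: "y c i = orbit G \<phi> x"
        by (auto simp: pts_of_type_def)
      obtain g where g: "g \<in> carrier G" "R c = conj_act G g (stabilizer G \<phi> x)"
        using conj_class_eq_iff[OF stabilizer_subgroup[OF x(1)] R_subgroup[OF c]] x R_class[OF c] by auto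
      then show ?thesis
        using x yx act_closed stabilizer_act orbit_act by (intro exI[of _ "\<phi> g x"]) auto
    qed
    then obtain x where x: "\<And>c i. c \<in> conj_classes G \<Longrightarrow> i < k c \<Longrightarrow>
        x c i \<in> topspace X \<and> stabilizer G \<phi> (x c i) = R c \<and> orbit G \<phi> (x c i) = y c i"
      by metis
    obtain f where f: "f \<in> topspace (gemb G (osum, osum_act) X \<phi>)"
      and fz: "orbit_conf f = (\<lambda>c \<in> conj_classes G. perm_class (k c) (y c))"
      using orbit_conf_realize[OF y x] .
    have "orbit_conf f = z"
      unfolding fz using zy z by (auto simp: restrict_def fun_eq_iff PiE_iff extensional_def)
    then show "z \<in> orbit_conf ` topspace (gemb G (osum, osum_act) X \<phi>)" using f by blast
  qed
qed

text \<open>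
  Near \<open>f\<close> there is no freedom to translate a representative as in the proof of surjectivity, since it
  has to stay in \<open>W\<close>. That its stabilizer is \<open>R c\<close> rather than some conjugate comes from the
  disjointness of the sets \<open>W s\<close>.
\<close>

lemma open_map_orbit_conf: "open_map (gemb G (osum, osum_act) X \<phi>) typed_confs orbit_conf"
proof (rule open_map_from_basepoints)
  fix U f assume U: "openin (gemb G (osum, osum_act) X \<phi>) U" and fU: "f \<in> U"
  have f: "f \<in> topspace (gemb G (osum, osum_act) X \<phi>)" using U fU openin_subset by blast
  obtain W where W: "\<And>s. s \<in> osum \<Longrightarrow> openin X (W s)" and fW: "\<And>s. s \<in> osum \<Longrightarrow> f s \<in> W s"
    and disj: "\<And>s t x. s \<in> osum \<Longrightarrow> t \<in> osum \<Longrightarrow> x \<in> W s \<Longrightarrow> x \<in> W t \<Longrightarrow> s = t"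
    and act: "\<And>g s x. g \<in> carrier G \<Longrightarrow> s \<in> osum \<Longrightarrow> x \<in> W s \<Longrightarrow> \<phi> g x \<in> W (osum_act g s)"
    and WU: "\<And>h. h \<in> topspace (gemb G (osum, osum_act) X \<phi>) \<Longrightarrow> \<forall>s \<in> osum. h s \<in> W s \<Longrightarrow> h \<in> U"
    by (rule gemb_invariant_neighbourhoods[OF osum_gset U fU]) blast
  define B where "B c = {y \<in> topspace (ordered_conf (orbit_space G \<phi> (stratum G \<phi> X c)) (k c)).
      \<forall>i<k c. y i \<in> orbit G \<phi> ` (W (c, i, R c) \<inter> pts_of_type c)}" for c
  define N where "N = (\<Pi>\<^sub>E c\<in>conj_classes G. perm_class (k c) ` B c)"
  have "openin (conf (orbit_space G \<phi> (stratum G \<phi> X c)) (k c)) (perm_class (k c) ` B c)"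
    if c: "c \<in> conj_classes G" for c
    unfolding B_def
    by (rule openin_conf_box) (rule openin_orbit_image[OF W[OF base_in_osum[OF c]]])
  then have "openin typed_confs N"
    using finite_conj_classes[OF finite_G] by (simp add: N_def openin_PiE_gen)
  moreover have "orbit_conf f \<in> N"
  proof -
    have "orbits_of_type f c \<in> B c" if c: "c \<in> conj_classes G" for c
      using orbits_of_type_ordered_conf[OF f c] emb_base_type[OF f c] fW base_in_osum[OF c]
      by (auto simp: B_def orbits_of_type_def)
    then show ?thesis by (simp add: N_def orbit_conf_def)
  qed
  moreover have "N \<subseteq> orbit_conf ` U"
  proof
    fix z assume z: "z \<in> N"
    then have "\<forall>c \<in> conj_classes G. \<exists>y \<in> B c. z c = perm_class (k c) y"
      by (auto simp: N_def PiE_iff)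
    then obtain y where y: "\<And>c. c \<in> conj_classes G \<Longrightarrow> y c \<in> B c"
      and zy: "\<And>c. c \<in> conj_classes G \<Longrightarrow> z c = perm_class (k c) (y c)"
      by metis
    have "\<forall>c i. \<exists>x. c \<in> conj_classes G \<longrightarrow> i < k c \<longrightarrow>
        x \<in> W (c, i, R c) \<and> x \<in> pts_of_type c \<and> y c i = orbit G \<phi> x"
      using y by (fastforce simp: B_def)
    then obtain x where xW: "\<And>c i. c \<in> conj_classes G \<Longrightarrow> i < k c \<Longrightarrow> x c i \<in> W (c, i, R c)"
      and x_type: "\<And>c i. c \<in> conj_classes G \<Longrightarrow> i < k c \<Longrightarrow> x c i \<in> pts_of_type c"
      and yx: "\<And>c i. c \<in> conj_classes G \<Longrightarrow> i < k c \<Longrightarrow> y c i = orbit G \<phi> (x c i)"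
      by metis
    have stab: "stabilizer G \<phi> (x c i) = R c" if c: "c \<in> conj_classes G" and i: "i < k c" for c i
    proof (rule conjugate_subset_eq[OF R_subgroup[OF c] _ finite_G])
      have xX: "x c i \<in> topspace X" and xc: "conj_class G (stabilizer G \<phi> (x c i)) = c"
        using x_type[OF c i] by (auto simp: pts_of_type_def)
      show "subgroup (stabilizer G \<phi> (x c i)) G" by (rule stabilizer_subgroup[OF xX])
      show "conj_class G (R c) = conj_class G (stabilizer G \<phi> (x c i))"
        using R_class[OF c] xc by simp
      show "stabilizer G \<phi> (x c i) \<subseteq> R c"
      proof
        fix g assume "g \<in> stabilizer G \<phi> (x c i)"
        then have g: "g \<in> carrier G" and gx: "\<phi> g (x c i) = x c i"
          by (auto simp: stabilizer_def)
        note b = base_in_osum[OF c i]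
        have "x c i \<in> W (osum_act g (c, i, R c))"
          using act[OF g b xW[OF c i]] gx by simp
        then have "osum_act g (c, i, R c) = (c, i, R c)"
          using disj[OF osum_act_closed[OF g b] b _ xW[OF c i]] by blast
        then show "g \<in> R c" using osum_act_base_fixed_iff[OF c i g] by simp
      qed
    qed
    have yc: "y c \<in> topspace (ordered_conf (orbit_space G \<phi> (stratum G \<phi> X c)) (k c))"
      if "c \<in> conj_classes G" for c
      using y[OF that] by (simp add: B_def)
    have x: "x c i \<in> topspace X \<and> stabilizer G \<phi> (x c i) = R c \<and> orbit G \<phi> (x c i) = y c i"
      if "c \<in> conj_classes G" "i < k c" for c i
      using that x_type stab yx by (simp add: pts_of_type_def)
    obtain h where h: "h \<in> topspace (gemb G (osum, osum_act) X \<phi>)"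
      and hz: "orbit_conf h = (\<lambda>c \<in> conj_classes G. perm_class (k c) (y c))"
      and hx: "\<forall>c \<in> conj_classes G. \<forall>i<k c. \<forall>g \<in> carrier G. h (osum_act g (c, i, R c)) = \<phi> g (x c i)"
      using orbit_conf_realize[OF yc x] .
    have "h s \<in> W s" if s: "s \<in> osum" for s
    proof -
      obtain c i g where ci: "c \<in> conj_classes G" "i < k c" and g: "g \<in> carrier G"
        and sg: "s = osum_act g (c, i, R c)" using osum_cases[OF s] .
      then show ?thesis
        using act[OF g base_in_osum[OF ci] xW[OF ci]] hx by simp
    qed
    then have "h \<in> U" using WU[OF h] by blast
    moreover have "orbit_conf h = z"
      unfolding hz using zy z by (auto simp: N_def restrict_def fun_eq_iff PiE_iff extensional_def)
    ultimately show "z \<in> orbit_conf ` U" by blast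
  qed
  ultimately show "\<exists>N. openin typed_confs N \<and> orbit_conf f \<in> N \<and> N \<subseteq> orbit_conf ` U" by blast
qed

theorem gconf_orbit_sum_decomposition:
  "gconf G (orbit_sum G R k) X \<phi> homeomorphic_space typed_confs"
proof -
  have fib: "aut_class G (osum, osum_act) f = aut_class G (osum, osum_act) h \<longleftrightarrow> orbit_conf f = orbit_conf h"
    if "f \<in> topspace (gemb G (osum, osum_act) X \<phi>)" "h \<in> topspace (gemb G (osum, osum_act) X \<phi>)" for f h
    using aut_class_eq_iff[OF osum_gset that] orbit_conf_eq_iff[OF that] by simp
  obtain \<Phi> where \<Phi>: "continuous_map (gconf G (osum, osum_act) X \<phi>) typed_confs \<Phi>"
    "open_map (gconf G (osum, osum_act) X \<phi>) typed_confs \<Phi>"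
    "inj_on \<Phi> (aut_class G (osum, osum_act) ` topspace (gemb G (osum, osum_act) X \<phi>))"
    and \<Phi>q: "\<And>f. f \<in> topspace (gemb G (osum, osum_act) X \<phi>) \<Longrightarrow> \<Phi> (aut_class G (osum, osum_act) f) = orbit_conf f"
    using quotient_topology_induced_map[OF continuous_map_orbit_conf open_map_orbit_conf fib]
    unfolding gconf_eq by blast
  have "\<Phi> ` topspace (gconf G (osum, osum_act) X \<phi>) = orbit_conf ` topspace (gemb G (osum, osum_act) X \<phi>)"
    using \<Phi>q by (simp add: gconf_eq image_image)
  then have "homeomorphic_map (gconf G (osum, osum_act) X \<phi>) typed_confs \<Phi>"
    using \<Phi> orbit_conf_surj by (intro bijective_open_imp_homeomorphic_map) (simp_all add: gconf_eq)
  then show ?thesis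
    unfolding orbit_sum_eq by (rule homeomorphic_map_imp_homeomorphic_space)
qed

end


section \<open>The decomposition theorem\<close>

theorem theoremC:
  fixes G :: "('g, 'm) monoid_scheme" and X :: "'x topology" and \<phi> :: "'g \<Rightarrow> 'x \<Rightarrow> 'x"
  assumes "group G" and "finite (carrier G)"
    and "G_space G X \<phi>" and "Hausdorff_space X"
  shows "(\<forall>(n::nat) S. (\<forall>c \<in> gset_iso_classes G n. S c \<in> c) \<longrightarrow>
            conf_fixed G \<phi> X n homeomorphic_space
              sum_topology (\<lambda>c. gconf G (S c) X \<phi>) (gset_iso_classes G n))
       \<and> (\<forall>R k. (\<forall>c \<in> conj_classes G. R c \<in> c) \<longrightarrow>
            gconf G (orbit_sum G R k) X \<phi> homeomorphic_space
              product_topology (\<lambda>c. conf (orbit_space G \<phi> (stratum G \<phi> X c)) (k c)) (conj_classes G))"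
proof -
  interpret Hausdorff_G_space G X \<phi>
    using assms unfolding G_space_def Hausdorff_G_space_def Hausdorff_G_space_axioms_def by blast
  show ?thesis
  proof (intro conjI allI impI)
    fix n :: nat and S :: "('g, nat) gset set \<Rightarrow> ('g, nat) gset"
    assume "\<forall>c \<in> gset_iso_classes G n. S c \<in> c"
    then show "conf_fixed G \<phi> X n homeomorphic_space
        sum_topology (\<lambda>c. gconf G (S c) X \<phi>) (gset_iso_classes G n)"
      by (intro conf_fixed_decomposition) blast
  next
    fix R :: "'g set set \<Rightarrow> 'g set" and k
    assume "\<forall>c \<in> conj_classes G. R c \<in> c"
    then interpret orbit_type_gset G X \<phi> R k
      by unfold_locales blast
    show "gconf G (orbit_sum G R k) X \<phi> homeomorphic_space
        product_topology (\<lambda>c. conf (orbit_space G \<phi> (stratum G \<phi> X c)) (k c)) (conj_classes G)"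
      by (rule gconf_orbit_sum_decomposition)
  qed
qed

end
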